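(* All outerplanar graphs are $(\frac{5}{2},4)^*$-colorable.
   Context: Graphs are finite, undirected and simple. An outerplanar graph is a graph with a planar drawing for which all vertices belong to the outer face of the drawing. For a positive integer $k$ and $i,j\in\{0,1,\dots,k-1\}$, the circular distance is $|i-j|_k=\min\{|i-j|,\,k-|i-j|\}$. For a nonnegative integer $t$, a $(\frac{k}{2},t)^*$-coloring of a graph $G$ is a mapping $f:V(G)\to\{0,1,\dots,k-1\}$ such that adjacent vertices receive different integers and, for each vertex $u$, the number of neighbors $v$ of $u$ with $|f(u)-f(v)|_k=1$ is at most $t$. $G$ is $(\frac{k}{2},t)^*$-colorable if it has such a coloring. *)

theory Defs
  imports "HOL-Analysis.Analysis"
begin

definition simple_graph :: "'a set \<Rightarrow> 'a set set \<Rightarrow> bool" where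
  "simple_graph V E \<longleftrightarrow> finite V \<and> (\<forall>e\<in>E. e \<subseteq> V \<and> card e = 2)"

text \<open>
  The plane is \<^typ>\<open>complex\<close>. The vertex \<^term>\<open>v\<close> is drawn as the point \<^term>\<open>p v\<close> and the edge
  \<^term>\<open>e\<close> as the arc (injective path) \<^term>\<open>c e\<close>, whose direction is irrelevant. Arcs pass through
  no vertices except their ends, and distinct arcs meet only in common ends.
\<close>

definition planar_drawing ::
    "'a set \<Rightarrow> 'a set set \<Rightarrow> ('a \<Rightarrow> complex) \<Rightarrow> ('a set \<Rightarrow> real \<Rightarrow> complex) \<Rightarrow> bool" where
  "planar_drawing V E p c \<longleftrightarrow>
     inj_on p V \<and>
     (\<forall>e\<in>E. arc (c e) \<and> {pathstart (c e), pathfinish (c e)} = p ` e \<and>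
              path_image (c e) \<inter> p ` V = p ` e) \<and>
     (\<forall>e\<in>E. \<forall>e'\<in>E. e \<noteq> e' \<longrightarrow> path_image (c e) \<inter> path_image (c e') \<subseteq> p ` (e \<inter> e'))"

definition drawing_points ::
    "'a set \<Rightarrow> 'a set set \<Rightarrow> ('a \<Rightarrow> complex) \<Rightarrow> ('a set \<Rightarrow> real \<Rightarrow> complex) \<Rightarrow> complex set" where
  "drawing_points V E p c = p ` V \<union> (\<Union>e\<in>E. path_image (c e))"

text \<open>
  The faces are the connected components of the complement of the drawing. As the drawing is
  compact, \<^const>\<open>outside\<close> of it is its unique unbounded face. Faces are open, so a vertex belongs
  to the outer face in the sense of lying on its boundary.
\<close>

definition outerplanar :: "'a set \<Rightarrow> 'a set set \<Rightarrow> bool" where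
  "outerplanar V E \<longleftrightarrow>
     (\<exists>p c. planar_drawing V E p c \<and> p ` V \<subseteq> frontier (outside (drawing_points V E p c)))"

text \<open>Integer-valued, so that the subtractions are not truncated.\<close>

definition circ_dist :: "nat \<Rightarrow> nat \<Rightarrow> nat \<Rightarrow> int" where
  "circ_dist k i j = min \<bar>int i - int j\<bar> (int k - \<bar>int i - int j\<bar>)"

text \<open>The parameter \<^term>\<open>k\<close> is the numerator in $(\frac{k}{2},t)^*$.\<close>

definition half_star_coloring ::
    "nat \<Rightarrow> nat \<Rightarrow> 'a set \<Rightarrow> 'a set set \<Rightarrow> ('a \<Rightarrow> nat) \<Rightarrow> bool" where
  "half_star_coloring k t V E f \<longleftrightarrow>
     f \<in> V \<rightarrow> {0..<k} \<and>
     (\<forall>u\<in>V. \<forall>v\<in>V. {u, v} \<in> E \<longrightarrow> f u \<noteq> f v) \<and>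
     (\<forall>u\<in>V. card {v \<in> V. {u, v} \<in> E \<and> circ_dist k (f u) (f v) = 1} \<le> t)"

definition half_star_colorable :: "nat \<Rightarrow> nat \<Rightarrow> 'a set \<Rightarrow> 'a set set \<Rightarrow> bool" where
  "half_star_colorable k t V E \<longleftrightarrow> (\<exists>f. half_star_coloring k t V E f)"

end

theory Submission
  imports Defs
begin

text \<open>
  In an outerplanar drawing, three internally disjoint paths between two vertices cannot all have an
  inner vertex: by the theta curve lemma one of them runs inside the closed curve formed by the other
  two. Hence there is no $K_{2,3}$ minor, and a similar argument excludes $K_4$ subgraphs.

  The coloring is built from pieces \<^term>\<open>K\<close> that are attached to the rest of the graph at two
  colored terminals \<^term>\<open>p\<close> and \<^term>\<open>q\<close>, which are treated as if they were adjacent. The excluded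
  minors provide a vertex \<^term>\<open>x\<close> separating \<^term>\<open>p\<close> from \<^term>\<open>q\<close> in \<^term>\<open>K\<close>, which plays the
  role of the apex of the triangle over the edge \<^term>\<open>p\<close>\<^term>\<open>q\<close> of a triangulated polygon. Call an
  edge bad if its ends have colors at circular distance 1. If \<^term>\<open>p\<close> and \<^term>\<open>q\<close> are at distance 1,
  then \<^term>\<open>x\<close> gets the color at distance 2 from both, and neither terminal receives a bad edge from
  \<^term>\<open>K\<close>. If they are at distance 2, then \<^term>\<open>x\<close> is at distance 2 from \<^term>\<open>p\<close> and 1 from
  \<^term>\<open>q\<close>, so \<^term>\<open>p\<close> receives no bad edge and \<^term>\<open>q\<close> at most one. At most two of the remaining pieces
  hang on \<^term>\<open>p\<close>\<^term>\<open>x\<close> and at most two on \<^term>\<open>q\<close>\<^term>\<open>x\<close>, which leaves \<^term>\<open>x\<close> with at most four bad edges.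
\<close>

section \<open>Theta curves\<close>

definition joins :: "(real \<Rightarrow> complex) \<Rightarrow> complex \<Rightarrow> complex \<Rightarrow> bool" where
  "joins g a b \<longleftrightarrow> arc g \<and> pathstart g = a \<and> pathfinish g = b"

lemma joinsD:
  assumes "joins g a b"
  shows "arc g" "pathstart g = a" "pathfinish g = b" "a \<in> path_image g" "b \<in> path_image g" "a \<noteq> b"
    "compact (path_image g)" "closed (path_image g)" "connected (path_image g)"
    "connected (path_image g - {a, b})"
proof -
  show *: "arc g" "pathstart g = a" "pathfinish g = b"
    using assms by (auto simp: joins_def)
  show "a \<in> path_image g" "b \<in> path_image g" using * by auto
  show "a \<noteq> b" using arc_distinct_ends * by blast
  show "compact (path_image g)" "closed (path_image g)" "connected (path_image g)"
    using * by (auto simp: compact_arc_image closed_arc_image connected_arc_image)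
  show "connected (path_image g - {a, b})"
    using connected_simple_path_endless[OF arc_imp_simple_path[OF *(1)]] * by simp
qed

lemma joins_reverse: "joins g a b \<Longrightarrow> joins (reversepath g) b a"
  by (simp add: joins_def arc_reversepath)

lemma joins_join:
  assumes "joins g a b" "joins h b d" "path_image g \<inter> path_image h \<subseteq> {b}"
  shows "joins (g +++ h) a d" "path_image (g +++ h) = path_image g \<union> path_image h"
  using assms by (auto simp: joins_def arc_join path_image_join)

text \<open>This is the image of the interval without its left end. Keeping the far end allows
  \<open>no_K4\<close> to conclude that a vertex is swallowed by a region.\<close>

lemma connected_half_open_arc:
  assumes "joins g a b"
  shows "connected (path_image g - {a})"
proof -
  have g: "inj_on g {0..1}" "continuous_on {0..1} g" "g 0 = a"
    using assms by (auto simp: joins_def arc_def path_def pathstart_def)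
  have "path_image g - {a} = g ` ({0..1} - {0})"
    using inj_on_image_set_diff[OF g(1), of "{0..1}" "{0}"] g(3) by (simp add: path_image_def)
  also have "{0..1} - {0} = {0<..1::real}" by auto
  also have "connected (g ` {0<..1})"
    by (intro connected_continuous_image continuous_on_subset[OF g(2)]) auto
  finally show ?thesis .
qed

text \<open>Running along \<open>g\<close> and back along \<open>h\<close> gives a simple closed
  curve, so the Jordan curve theorem applies.\<close>

lemma Jordan_two_arcs:
  assumes g: "joins g a b" and h: "joins h a b" and gh: "path_image g \<inter> path_image h = {a, b}"
  defines "J \<equiv> path_image g \<union> path_image h"
  shows "inside J \<noteq> {}" "connected (inside J)" "connected (outside J)" "frontier (inside J) = J"
proof -
  have J: "J = path_image (g +++ reversepath h)"
    using g h by (simp add: J_def joins_def path_image_join)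
  have "simple_path (g +++ reversepath h)"
    using g h gh by (intro simple_path_join_loop) (auto simp: joins_def arc_reversepath)
  moreover have "pathfinish (g +++ reversepath h) = pathstart (g +++ reversepath h)"
    using g h by (simp add: joins_def)
  ultimately show "inside J \<noteq> {}" "connected (inside J)" "connected (outside J)" "frontier (inside J) = J"
    using Jordan_inside_outside unfolding J by blast+
qed

text \<open>The set \<open>inside J\<close> is a union of components of the complement of
  \<open>J\<close>, and \<open>T\<close> lies within a single component.\<close>

lemma connected_subset_inside:
  assumes "connected T" "T \<inter> J = {}" "x \<in> T" "x \<in> inside J"
  shows "T \<subseteq> inside J"
proof
  fix y assume "y \<in> T"
  with assms have "connected_component (- J) x y"
    by (auto simp: connected_component_def)
  with assms(4) show "y \<in> inside J" by (metis inside_same_component)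
qed

text \<open>Janiszewski's theorem for the two closed curves through \<^term>\<open>g3\<close>, whose intersection is connected.\<close>

lemma connected_component_outside_theta:
  assumes g1: "joins g1 a b" and g2: "joins g2 a b" and g3: "joins g3 a b"
    and i13: "path_image g1 \<inter> path_image g3 = {a, b}"
    and i23: "path_image g2 \<inter> path_image g3 = {a, b}"
    and i12: "path_image g1 \<inter> path_image g2 = {a, b}"
    and x13: "x \<in> outside (path_image g1 \<union> path_image g3)"
    and x23: "x \<in> outside (path_image g2 \<union> path_image g3)"
  shows "x \<in> outside (path_image g1 \<union> path_image g2)"
proof -
  let ?A = "path_image g1 \<union> path_image g3" and ?B = "path_image g2 \<union> path_image g3"
  have compact: "compact ?A" "compact ?B" using g1 g2 g3 joinsD(7) by (blast intro: compact_Un)+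
  then have "bounded (?A \<union> ?B)" using compact_Un compact_imp_bounded by blast
  then have "outside (?A \<union> ?B) \<noteq> {}" by (rule outside_bounded_nonempty)
  \<comment> \<open>A reference point in the unbounded region of all three arcs. It is joined to
    \<open>x\<close> off \<open>?A\<close> and off \<open>?B\<close>, hence off their union.\<close>
  then obtain y where y: "y \<in> outside (?A \<union> ?B)" by blast
  then have yA: "y \<in> outside ?A" and yB: "y \<in> outside ?B"
    using outside_mono[of ?A "?A \<union> ?B"] outside_mono[of ?B "?A \<union> ?B"] by blast+
  have "connected_component (- ?A) y x"
    using Jordan_two_arcs(3)[OF g1 g3 i13] yA x13 outside_no_overlap[of ?A]
    unfolding connected_component_def by blast
  moreover have "connected_component (- ?B) y x"
    using Jordan_two_arcs(3)[OF g2 g3 i23] yB x23 outside_no_overlap[of ?B]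
    unfolding connected_component_def by blast
  moreover have "?A \<inter> ?B = path_image g3"
    using i12 joinsD(4,5)[OF g3] by auto
  ultimately have "connected_component (- (?A \<union> ?B)) y x"
    using Janiszewski[of ?A ?B y x] compact joinsD(9)[OF g3] by (simp add: compact_imp_closed)
  then have "x \<in> outside (?A \<union> ?B)" using y by (rule outside_same_component)
  then show ?thesis using outside_mono[of "path_image g1 \<union> path_image g2" "?A \<union> ?B"] by blast
qed

text \<open>The inside of the first curve is connected and avoids \<open>g3\<close>, so the common
  point \<open>x\<close> puts all of it inside the second curve. Passing to closures carries
  \<open>g2\<close>, a part of its frontier, along.\<close>

lemma theta_nested_inside:
  assumes g1: "joins g1 a b" and g2: "joins g2 a b" and g3: "joins g3 a b"
    and i12: "path_image g1 \<inter> path_image g2 = {a, b}"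
    and i13: "path_image g1 \<inter> path_image g3 = {a, b}"
    and x: "x \<in> inside (path_image g1 \<union> path_image g2)" "x \<in> inside (path_image g1 \<union> path_image g3)"
    and out: "path_image g3 \<inter> inside (path_image g1 \<union> path_image g2) = {}"
    and i23: "path_image g2 \<inter> path_image g3 = {a, b}"
  shows "path_image g2 - {a, b} \<subseteq> inside (path_image g1 \<union> path_image g3)"
proof -
  let ?A = "path_image g1 \<union> path_image g2" and ?B = "path_image g1 \<union> path_image g3"
  have "inside ?A \<inter> ?A = {}" using inside_no_overlap[of ?A] by blast
  then have disj: "inside ?A \<inter> ?B = {}" using out by blast
  have sub: "inside ?A \<subseteq> inside ?B"
    using connected_subset_inside[OF Jordan_two_arcs(2)[OF g1 g2 i12] disj x] .
  have "closed ?B" using joinsD(8)[OF g1] joinsD(8)[OF g3] by blast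
  then have "closure (inside ?A) \<subseteq> ?B \<union> inside ?B"
    using closure_mono[OF sub] closure_inside_subset[of ?B] by blast
  then have "?A \<subseteq> ?B \<union> inside ?B"
    using Jordan_two_arcs(4)[OF g1 g2 i12] unfolding frontier_def by blast
  then show ?thesis using i12 i23 by blast
qed

text \<open>If \<open>g3\<close> enters the inside of the other two arcs, it cannot leave again.
  Otherwise a point inside \<open>g1\<close> and \<open>g2\<close> is, by the contrapositive of
  \<open>connected_component_outside_theta\<close>, inside one of the two curves through
  \<open>g3\<close>, and these curves are nested.\<close>

lemma theta_inside:
  assumes g1: "joins g1 a b" and g2: "joins g2 a b" and g3: "joins g3 a b"
    and i12: "path_image g1 \<inter> path_image g2 = {a, b}"
    and i13: "path_image g1 \<inter> path_image g3 = {a, b}"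
    and i23: "path_image g2 \<inter> path_image g3 = {a, b}"
  shows "path_image g1 - {a, b} \<subseteq> inside (path_image g2 \<union> path_image g3) \<or>
         path_image g2 - {a, b} \<subseteq> inside (path_image g1 \<union> path_image g3) \<or>
         path_image g3 - {a, b} \<subseteq> inside (path_image g1 \<union> path_image g2)"
proof (cases "path_image g3 \<inter> inside (path_image g1 \<union> path_image g2) = {}")
  case True
  let ?A = "path_image g1 \<union> path_image g2" and ?B = "path_image g1 \<union> path_image g3"
    and ?C = "path_image g2 \<union> path_image g3"
  obtain x where x: "x \<in> inside ?A" using Jordan_two_arcs(1)[OF g1 g2 i12] by blast
  have "x \<notin> outside ?A" using x inside_Int_outside[of ?A] by blast
  then have "x \<notin> outside ?B \<or> x \<notin> outside ?C"
    using connected_component_outside_theta[OF g1 g2 g3 i13 i23 i12] by blast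
  moreover have "x \<notin> ?A \<union> ?B"
    using True x inside_no_overlap[of ?A] by blast
  ultimately consider "x \<in> inside ?B" | "x \<in> inside ?C"
    using inside_Un_outside[of ?B] inside_Un_outside[of ?C] by blast
  then show ?thesis
  proof cases
    case 1
    then show ?thesis using theta_nested_inside[OF g1 g2 g3 i12 i13 x _ True i23] by blast
  next
    case 2
    then show ?thesis
      using theta_nested_inside[OF g2 g1 g3 _ i23 _ _ _ i13] x True i12 by (auto simp: Un_commute Int_commute)
  qed
next
  case False
  let ?A = "path_image g1 \<union> path_image g2"
  obtain x where x: "x \<in> path_image g3" "x \<in> inside ?A" using False by blast
  have "x \<notin> ?A" using x inside_no_overlap[of ?A] by blast
  then have "x \<in> path_image g3 - {a, b}" using x i13 by blast
  moreover have "(path_image g3 - {a, b}) \<inter> ?A = {}" using i13 i23 by blast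
  ultimately show ?thesis
    using connected_subset_inside[OF joinsD(10)[OF g3]] x by blast
qed

section \<open>Outerplanar drawings\<close>

definition touch :: "'a set set \<Rightarrow> 'a set \<Rightarrow> 'a set \<Rightarrow> bool" where
  "touch E A B \<longleftrightarrow> (\<exists>a\<in>A. \<exists>b\<in>B. {a, b} \<in> E)"

text \<open>Connectedness of the subgraph induced on \<open>S\<close>, expressed by cuts, so that
  branch sets can be merged and divided without handling walks.\<close>

definition conn :: "'a set set \<Rightarrow> 'a set \<Rightarrow> bool" where
  "conn E S \<longleftrightarrow> S \<noteq> {} \<and> (\<forall>A. A \<subseteq> S \<and> A \<noteq> {} \<and> A \<noteq> S \<longrightarrow> touch E A (S - A))"

lemma conn_singleton [simp]: "conn E {x}"
  by (auto simp: conn_def)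

section \<open>Subdrawings and the arcs they contain\<close>

locale drawing =
  fixes V :: "'a set" and E :: "'a set set" and p :: "'a \<Rightarrow> complex"
    and c :: "'a set \<Rightarrow> real \<Rightarrow> complex"
  assumes simple: "simple_graph V E" and planar: "planar_drawing V E p c"
begin

abbreviation "drawn S F \<equiv> drawing_points S F p c"

lemma finite_E: "finite E"
  using simple by (meson PowI finite_Pow_iff finite_subset simple_graph_def subsetI)

lemma arc_ends:
  assumes "e \<in> E" "e = {u, v}"
  shows "path_connected (path_image (c e))" "p u \<in> path_image (c e)" "p v \<in> path_image (c e)"
    "compact (path_image (c e))"
proof -
  have *: "arc (c e)" "{pathstart (c e), pathfinish (c e)} = p ` e"
    using planar assms(1) by (auto simp: planar_drawing_def)
  show "path_connected (path_image (c e))" "compact (path_image (c e))"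
    using *(1) by (auto simp: arc_imp_path path_connected_path_image compact_arc_image)
  show "p u \<in> path_image (c e)" "p v \<in> path_image (c e)"
    using *(2) assms(2) pathstart_in_path_image[of "c e"] pathfinish_in_path_image[of "c e"]
    by (auto simp: doubleton_eq_iff)
qed

text \<open>An arc meets the vertices only in its ends and another arc only in common ends, so
  subdrawings without common edges meet only in common vertices.\<close>

lemma drawn_Int:
  assumes S: "S \<subseteq> V" "T \<subseteq> V" and F: "F \<subseteq> E" "G \<subseteq> E" "\<Union>F \<subseteq> S" "\<Union>G \<subseteq> T" "F \<inter> G = {}"
  shows "drawn S F \<inter> drawn T G \<subseteq> p ` (S \<inter> T)"
proof -
  have inj: "inj_on p V" and
    vtx: "\<And>e. e \<in> E \<Longrightarrow> path_image (c e) \<inter> p ` V = p ` e" and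
    edge: "\<And>e e'. \<lbrakk>e \<in> E; e' \<in> E; e \<noteq> e'\<rbrakk> \<Longrightarrow> path_image (c e) \<inter> path_image (c e') \<subseteq> p ` (e \<inter> e')"
    using planar by (auto simp: planar_drawing_def)
  have im: "p ` A \<inter> p ` B = p ` (A \<inter> B)" if "A \<subseteq> V" "B \<subseteq> V" for A B
    using inj that by (metis inj_on_image_Int)
  have EV: "e \<subseteq> V" if "e \<in> E" for e using that simple by (auto simp: simple_graph_def)
  have "x \<in> p ` (S \<inter> T)" if x: "x \<in> drawn S F" "x \<in> drawn T G" for x
  proof -
    consider "x \<in> p ` S" "x \<in> p ` T"
      | e where "e \<in> F" "x \<in> path_image (c e)" "x \<in> p ` T"
      | e where "e \<in> G" "x \<in> path_image (c e)" "x \<in> p ` S"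
      | e e' where "e \<in> F" "e' \<in> G" "x \<in> path_image (c e)" "x \<in> path_image (c e')"
      using x by (auto simp: drawing_points_def)
    then show ?thesis
    proof cases
      case 1
      then show ?thesis using im S by blast
    next
      case 2
      then have "x \<in> p ` e" using vtx[of e] S F by blast
      moreover have "e \<subseteq> S" using 2 F by blast
      ultimately show ?thesis using im S 2 by blast
    next
      case 3
      then have "x \<in> p ` e" using vtx[of e] S F by blast
      moreover have "e \<subseteq> T" using 3 F by blast
      ultimately show ?thesis using im S 3 by blast
    next
      case 4
      then have "e \<noteq> e'" "e \<in> E" "e' \<in> E" using F by blast+
      then have "x \<in> p ` (e \<inter> e')" using edge[of e e'] 4 by blast
      moreover have "e \<inter> e' \<subseteq> S \<inter> T" using 4 F by blast
      ultimately show ?thesis by blast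
    qed
  qed
  then show ?thesis by blast
qed

text \<open>No edge of \<open>F\<close> leaves the set of vertices reachable from a fixed vertex
  within the drawing, so this set is all of \<open>S\<close>.\<close>

lemma path_connected_drawn:
  assumes "F \<subseteq> E" "\<Union>F \<subseteq> S" "conn F S"
  shows "path_connected (drawn S F)"
proof -
  let ?D = "drawn S F"
  obtain a where a: "a \<in> S" using assms(3) by (auto simp: conn_def)
  define A where "A = {s \<in> S. path_component ?D (p a) (p s)}"
  have pD: "p s \<in> ?D" if "s \<in> S" for s using that by (auto simp: drawing_points_def)
  have edge: "path_component ?D (p u) x" if "u \<in> e" "e \<in> F" "x \<in> path_image (c e)" for u e x
  proof -
    have "card e = 2" using \<open>e \<in> F\<close> assms(1) simple by (auto simp: simple_graph_def)
    then obtain y z where "e = {y, z}" by (auto simp: card_2_iff)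
    then have "\<exists>v. e = {u, v}" using \<open>u \<in> e\<close> by auto
    then obtain v where "e = {u, v}" by blast
    then have "path_connected (path_image (c e))" "p u \<in> path_image (c e)"
      using arc_ends that(2) assms(1) by blast+
    moreover have "path_image (c e) \<subseteq> ?D" using that(2) by (auto simp: drawing_points_def)
    ultimately show ?thesis using that(3)
      by (meson path_component_of_subset path_connected_component)
  qed
  have "A = S"
  proof (rule ccontr)
    assume "A \<noteq> S"
    have "a \<in> A" using a pD path_component_refl unfolding A_def by blast
    have "touch F A (S - A)"
    proof -
      have "A \<subseteq> S" unfolding A_def by blast
      then show ?thesis using \<open>A \<noteq> S\<close> \<open>a \<in> A\<close> assms(3) unfolding conn_def by blast
    qed
    then obtain u v where uv: "u \<in> A" "v \<in> S - A" "{u, v} \<in> F" by (auto simp: touch_def)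
    have "p v \<in> path_image (c {u, v})" using arc_ends(3) uv(3) assms(1) by blast
    then have "path_component ?D (p u) (p v)" using edge[of u "{u,v}"] uv by blast
    then have "v \<in> A" using uv path_component_trans unfolding A_def by blast
    then show False using uv by blast
  qed
  then have *: "path_component ?D (p a) (p s)" if "s \<in> S" for s using that A_def by blast
  have **: "path_component ?D (p a) x" if "x \<in> ?D" for x
  proof -
    consider s where "s \<in> S" "x = p s" | e where "e \<in> F" "x \<in> path_image (c e)"
      using \<open>x \<in> ?D\<close> by (auto simp: drawing_points_def)
    then show ?thesis
    proof cases
      case 1 then show ?thesis using * by blast
    next
      case 2
      have "card e = 2" using 2 assms(1) simple by (auto simp: simple_graph_def)
      then obtain u where "u \<in> e" by fastforce
      then show ?thesis using edge[of u e x] *[of u] 2 assms(2) path_component_trans by blast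
    qed
  qed
  then show ?thesis unfolding path_connected_component
    by (meson path_component_sym path_component_trans)
qed

lemma arc_in_drawn:
  assumes "F \<subseteq> E" "\<Union>F \<subseteq> S" "S \<subseteq> V" "conn F S" "a \<in> S" "b \<in> S" "a \<noteq> b"
  obtains g where "joins g (p a) (p b)" "path_image g \<subseteq> drawn S F"
proof -
  have "p a \<noteq> p b"
  proof -
    have "inj_on p V" using planar by (simp add: planar_drawing_def)
    then show ?thesis using assms(3,5-7) by (auto dest: inj_onD)
  qed
  moreover have "p a \<in> drawn S F" "p b \<in> drawn S F" using assms by (auto simp: drawing_points_def)
  ultimately show ?thesis using path_connected_drawn[OF assms(1,2,4)] that
    unfolding path_connected_arcwise joins_def by blast
qed

text \<open>
  Off the points of \<^term>\<open>B\<close>, the edges at \<^term>\<open>a\<close> and the other edges are disjoint closed sets, so a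
  connected set avoiding \<^term>\<open>B\<close> cannot reach \<^term>\<open>b\<close> from \<^term>\<open>a\<close>.
\<close>

lemma arc_meets_vertex:
  assumes "F \<subseteq> E" "\<Union>F \<subseteq> insert a (insert b B)" "\<And>e. e \<in> F \<Longrightarrow> e \<inter> B \<noteq> {}"
    "insert a (insert b B) \<subseteq> V" "a \<noteq> b"
    and g: "joins g (p a) (p b)" "path_image g \<subseteq> drawn (insert a (insert b B)) F"
  shows "\<exists>w\<in>B. p w \<in> path_image g"
proof (rule ccontr)
  assume no: "\<not> ?thesis"
  define F1 where "F1 = {e \<in> F. a \<in> e}"
  define X where "X = drawn {a} F1"
  define Y where "Y = drawn {b} (F - F1)"
  have "finite F" using finite_E assms(1) finite_subset by blast
  moreover have "closed (path_image (c e))" if "e \<in> F" for e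
  proof -
    have "e \<in> E" "arc (c e)" using that assms(1) planar by (auto simp: planar_drawing_def)
    then show ?thesis by (simp add: closed_arc_image)
  qed
  ultimately have cl: "closed X" "closed Y"
    unfolding X_def Y_def F1_def drawing_points_def by (simp_all add: closed_Un closed_UN)
  \<comment> \<open>The vertex sets grow to contain all ends of the edges, as
    \<open>drawn_Int\<close> demands.\<close>
  have Xsub: "X \<subseteq> drawn (\<Union>(insert {a} F1)) F1" and Ysub: "Y \<subseteq> drawn (\<Union>(insert {b} (F - F1))) (F - F1)"
    by (auto simp: X_def Y_def drawing_points_def)
  have card: "card e = 2" if "e \<in> F" for e using that assms(1) simple by (auto simp: simple_graph_def)
  \<comment> \<open>An edge with ends \<open>a\<close> and \<open>b\<close> can meet
    \<open>B\<close> only in one of them. As both are ends of \<open>g\<close>, this would put a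
    point of \<open>B\<close> on \<open>g\<close> after all.\<close>
  have nb: "b \<notin> e" if "e \<in> F1" for e
  proof
    assume "b \<in> e"
    have e: "a \<in> e" "e \<in> F" using that unfolding F1_def by simp_all
    obtain y z where "e = {y, z}" using card[OF e(2)] by (auto simp: card_2_iff)
    then have "e = {a, b}" using \<open>b \<in> e\<close> e(1) assms(5) by auto
    then have "a \<in> B \<or> b \<in> B" using assms(3)[OF e(2)] by auto
    then show False
    proof
      assume "a \<in> B"
      then show False using no joinsD(4)[OF g(1)] by simp
    next
      assume "b \<in> B"
      then show False using no joinsD(5)[OF g(1)] by simp
    qed
  qed
  let ?S = "\<Union>(insert {a} F1)" and ?T = "\<Union>(insert {b} (F - F1))"
  have inB: "x \<in> B" if "e \<in> F" "x \<in> e" "x \<noteq> a" "x \<noteq> b" for e x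
    using subsetD[OF assms(2) UnionI[OF that(1,2)]] that(3,4) by simp
  have S: "?S \<subseteq> insert a B"
  proof
    fix x assume "x \<in> ?S"
    then show "x \<in> insert a B" using inB[of _ x] nb by (auto simp: F1_def)
  qed
  have T: "?T \<subseteq> insert b B"
  proof
    fix x assume "x \<in> ?T"
    then show "x \<in> insert b B" using inB[of _ x] by (auto simp: F1_def)
  qed
  have "insert a B \<inter> insert b B \<subseteq> B" using assms(5) by auto
  then have "?S \<inter> ?T \<subseteq> B" using Int_mono[OF S T] by (rule order_trans[rotated])
  moreover have "drawn ?S F1 \<inter> drawn ?T (F - F1) \<subseteq> p ` (?S \<inter> ?T)"
  proof (rule drawn_Int)
    show "?S \<subseteq> V" "?T \<subseteq> V" using S T assms(4) by (meson insert_subset order_trans)+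
    show "F1 \<subseteq> E" "F - F1 \<subseteq> E" using assms(1) unfolding F1_def by blast+
  qed auto
  ultimately have "drawn ?S F1 \<inter> drawn ?T (F - F1) \<subseteq> p ` B" by (meson image_mono order_trans)
  then have "X \<inter> Y \<subseteq> p ` B" using Int_mono[OF Xsub Ysub] by (rule order_trans[rotated])
  then have "X \<inter> Y \<inter> path_image g = {}" using no by blast
  moreover have "path_image g \<subseteq> X \<union> Y"
  proof
    fix x assume x: "x \<in> path_image g"
    then have "x \<in> drawn (insert a (insert b B)) F" "x \<notin> p ` B" using g no by auto
    then show "x \<in> X \<union> Y" by (auto simp: drawing_points_def X_def Y_def F1_def)
  qed
  moreover have "p a \<in> X \<inter> path_image g" "p b \<in> Y \<inter> path_image g"
    using joinsD(4,5)[OF g(1)] by (auto simp: X_def Y_def drawing_points_def)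
  ultimately show False
    using joinsD(9)[OF g(1)] cl unfolding connected_closed by blast
qed

text \<open>Only edges meeting \<open>B\<close> are used, so an edge between \<open>a\<close> and
  \<open>b\<close> is excluded and the arc has to pass through a vertex of \<open>B\<close>. The
  inner vertex is what makes the arc contradict outerplanarity later.\<close>

lemma joins_through:
  assumes a: "a \<in> V" "a \<notin> B" and b: "b \<in> V" "b \<notin> B" and "a \<noteq> b"
    and B: "B \<subseteq> V" "conn E B" "touch E {a} B" "touch E {b} B"
  obtains g w where "joins g (p a) (p b)"
    "path_image g \<subseteq> drawn (insert a (insert b B)) {e \<in> E. e \<subseteq> insert a (insert b B) \<and> e \<inter> B \<noteq> {}}"
    "w \<in> B" "p w \<in> path_image g"
proof -
  define F where "F = {e \<in> E. e \<subseteq> insert a (insert b B) \<and> e \<inter> B \<noteq> {}}"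
  have conn: "conn F (insert a (insert b B))"
    unfolding conn_def
  proof (intro conjI allI impI)
    show "insert a (insert b B) \<noteq> {}" by simp
    fix A assume A: "A \<subseteq> insert a (insert b B) \<and> A \<noteq> {} \<and> A \<noteq> insert a (insert b B)"
    obtain x y where x: "x \<in> B" "{a, x} \<in> E" and y: "y \<in> B" "{b, y} \<in> E"
      using B by (auto simp: touch_def)
    have xy: "{a, x} \<in> F" "{b, y} \<in> F" "{x, a} \<in> F" "{y, b} \<in> F"
      using x y by (auto simp: F_def insert_commute)
    consider "A \<inter> B = {}" | "B \<subseteq> A" | "A \<inter> B \<noteq> {}" "A \<inter> B \<noteq> B" by blast
    then show "touch F A (insert a (insert b B) - A)"
    proof cases
      case 1
      then show ?thesis using A xy x y unfolding touch_def by blast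
    next
      case 2
      then show ?thesis using A xy x y unfolding touch_def by blast
    next
      case 3
      then have "touch E (A \<inter> B) (B - A \<inter> B)" using B(2) unfolding conn_def by blast
      then show ?thesis unfolding touch_def F_def by blast
    qed
  qed
  have FE: "F \<subseteq> E" and FS: "\<Union>F \<subseteq> insert a (insert b B)" by (auto simp: F_def)
  have SV: "insert a (insert b B) \<subseteq> V" using a b B by auto
  obtain g where g: "joins g (p a) (p b)" "path_image g \<subseteq> drawn (insert a (insert b B)) F"
    by (rule arc_in_drawn[OF FE FS SV conn _ _ \<open>a \<noteq> b\<close>]) auto
  have "\<exists>w\<in>B. p w \<in> path_image g"
    by (rule arc_meets_vertex[OF FE FS _ SV \<open>a \<noteq> b\<close> g]) (simp add: F_def)
  then obtain w where "w \<in> B" "p w \<in> path_image g" ..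
  with g show thesis unfolding F_def by (rule that)
qed

abbreviation "edge_arc x y \<equiv> path_image (c {x, y})"

lemma edge_Int:
  assumes "{x, y} \<in> E" "{x, z} \<in> E" "y \<noteq> z"
  shows "edge_arc x y \<inter> edge_arc x z = {p x}"
proof -
  have "x \<noteq> y" "x \<noteq> z" using assms simple by (auto simp: simple_graph_def)
  then have "{x, y} \<noteq> {x, z}" "{x, y} \<inter> {x, z} = {x}" using assms(3) by auto
  then have "edge_arc x y \<inter> edge_arc x z \<subseteq> p ` {x}"
    using planar assms(1,2) unfolding planar_drawing_def by metis
  then show ?thesis using arc_ends(2)[OF assms(1) refl] arc_ends(2)[OF assms(2) refl] by blast
qed

lemma edge_disjoint:
  assumes "{x, y} \<in> E" "{z, w} \<in> E" "{x, y} \<inter> {z, w} = {}"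
  shows "edge_arc x y \<inter> edge_arc z w = {}"
proof -
  have "{x, y} \<noteq> {z, w}" using assms(3) by blast
  then have "edge_arc x y \<inter> edge_arc z w \<subseteq> p ` {}"
    using planar assms unfolding planar_drawing_def by metis
  then show ?thesis by blast
qed

lemma edge_joins:
  assumes "{x, y} \<in> E"
  obtains g where "joins g (p x) (p y)" "path_image g = edge_arc x y"
proof -
  have "arc (c {x, y})" "{pathstart (c {x, y}), pathfinish (c {x, y})} = {p x, p y}"
    using planar assms by (auto simp: planar_drawing_def)
  then have "joins (c {x, y}) (p x) (p y) \<or> joins (reversepath (c {x, y})) (p x) (p y)"
    by (auto simp: joins_def doubleton_eq_iff arc_reversepath)
  then show ?thesis using that by auto
qed

lemma edge2_joins:
  assumes "{x, s} \<in> E" "{s, y} \<in> E" "x \<noteq> y"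
  obtains g where "joins g (p x) (p y)" "path_image g = edge_arc x s \<union> edge_arc s y"
proof -
  obtain g where g: "joins g (p x) (p s)" "path_image g = edge_arc x s" using edge_joins assms(1) by blast
  obtain h where h: "joins h (p s) (p y)" "path_image h = edge_arc s y" using edge_joins assms(2) by blast
  have "path_image g \<inter> path_image h \<subseteq> {p s}"
    using edge_Int[of s x y] assms g(2) h(2) by (simp add: insert_commute)
  then show ?thesis using joins_join[OF g(1) h(1)] g h that by simp
qed

end

section \<open>Theta curves and K_4 in outerplanar drawings\<close>

locale outerplanar_drawing = drawing +
  assumes outer: "p ` V \<subseteq> frontier (outside (drawing_points V E p c))"
begin

text \<open>A vertex is a limit of points outside the whole drawing. The open set
  \<open>inside J\<close> would contain such a point, which is outside the smaller set
  \<open>J\<close> as well.\<close>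

lemma vertex_not_inside:
  assumes "v \<in> V" "J \<subseteq> drawing_points V E p c" "closed J"
  shows "p v \<notin> inside J"
proof
  assume v: "p v \<in> inside J"
  have "p v \<in> closure (outside (drawing_points V E p c))"
    using outer assms(1) by (auto simp: frontier_def)
  moreover have "open (inside J)" using assms(3) by (rule open_inside)
  ultimately obtain x where "x \<in> inside J" "x \<in> outside (drawing_points V E p c)"
    using v by (metis disjoint_iff open_Int_closure_eq_empty)
  then show False using outside_mono[OF assms(2)] inside_Int_outside[of J] by blast
qed

text \<open>For disjoint branches avoiding \<open>a\<close> and \<open>b\<close> these sets are
  disjoint: an edge between \<open>a\<close> and \<open>b\<close> belongs to none of them.\<close>

definition "theta_edges a b B = {e \<in> E. e \<subseteq> insert a (insert b B) \<and> e \<inter> B \<noteq> {}}"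

lemma joins_through_outer:
  assumes "a \<in> V" "b \<in> V" "a \<noteq> b" "a \<notin> B" "b \<notin> B"
    and B: "B \<subseteq> V" "conn E B" "touch E {a} B" "touch E {b} B"
  obtains g w where "joins g (p a) (p b)"
    "path_image g \<subseteq> drawn (insert a (insert b B)) (theta_edges a b B)"
    "path_image g \<subseteq> drawing_points V E p c" "closed (path_image g)"
    "w \<in> V" "p w \<in> path_image g - {p a, p b}"
proof -
  obtain g w where g: "joins g (p a) (p b)"
    "path_image g \<subseteq> drawn (insert a (insert b B)) (theta_edges a b B)"
    "w \<in> B" "p w \<in> path_image g"
    unfolding theta_edges_def by (rule joins_through[OF assms(1,4,2,5,3) B])
  have "drawn (insert a (insert b B)) (theta_edges a b B) \<subseteq> drawing_points V E p c"
    using assms(1,2) B(1) by (auto simp: drawing_points_def theta_edges_def)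
  moreover have "w \<in> V" using g(3) B(1) by blast
  moreover have "inj_on p V" using planar by (simp add: planar_drawing_def)
  then have "p w \<noteq> p a" "p w \<noteq> p b"
    using \<open>w \<in> V\<close> assms(1,2,4,5) g(3) by (metis inj_onD)+
  ultimately show thesis
    using g(1,2,4) that[of g w] joinsD(8)[OF g(1)] by (meson DiffI empty_iff insert_iff order_trans)
qed

lemma theta_arcs_Int:
  assumes g: "joins g (p a) (p b)" "path_image g \<subseteq> drawn (insert a (insert b B)) (theta_edges a b B)"
    and h: "joins h (p a) (p b)" "path_image h \<subseteq> drawn (insert a (insert b C)) (theta_edges a b C)"
    and BC: "B \<inter> C = {}" "insert a (insert b B) \<subseteq> V" "insert a (insert b C) \<subseteq> V"
      "a \<notin> B \<union> C" "b \<notin> B \<union> C"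
  shows "path_image g \<inter> path_image h = {p a, p b}"
proof
  have "drawn (insert a (insert b B)) (theta_edges a b B) \<inter> drawn (insert a (insert b C)) (theta_edges a b C)
      \<subseteq> p ` (insert a (insert b B) \<inter> insert a (insert b C))"
  proof (rule drawn_Int[OF BC(2,3)])
    have "e \<notin> theta_edges a b C" if eB: "e \<in> theta_edges a b B" for e
    proof
      assume e: "e \<in> theta_edges a b C"
      obtain x where "x \<in> e" "x \<in> B" using eB unfolding theta_edges_def by blast
      then show False using e BC(1,4,5) unfolding theta_edges_def by blast
    qed
    then show "theta_edges a b B \<inter> theta_edges a b C = {}" by blast
  qed (simp_all add: theta_edges_def Sup_le_iff)
  also have "insert a (insert b B) \<inter> insert a (insert b C) = {a, b}" using BC(1,4,5) by auto
  finally have "drawn (insert a (insert b B)) (theta_edges a b B) \<inter>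
    drawn (insert a (insert b C)) (theta_edges a b C) \<subseteq> {p a, p b}" by simp
  then show "path_image g \<inter> path_image h \<subseteq> {p a, p b}"
    using Int_mono[OF g(2) h(2)] by (rule order_trans[rotated])
  show "{p a, p b} \<subseteq> path_image g \<inter> path_image h"
    using joinsD(4,5)[OF g(1)] joinsD(4,5)[OF h(1)] by simp
qed

text \<open>Each branch supplies an arc with an inner vertex. By \<open>theta_inside\<close> one of
  the three arcs, including its inner vertex, runs inside the curve of the other two, against
  \<open>vertex_not_inside\<close>.\<close>

lemma no_theta:
  assumes a: "a \<in> V" "a \<notin> B1 \<union> B2 \<union> B3" and b: "b \<in> V" "b \<notin> B1 \<union> B2 \<union> B3" and "a \<noteq> b"
    and B1: "B1 \<subseteq> V" "conn E B1" "touch E {a} B1" "touch E {b} B1"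
    and B2: "B2 \<subseteq> V" "conn E B2" "touch E {a} B2" "touch E {b} B2"
    and B3: "B3 \<subseteq> V" "conn E B3" "touch E {a} B3" "touch E {b} B3"
    and disj: "B1 \<inter> B2 = {}" "B1 \<inter> B3 = {}" "B2 \<inter> B3 = {}"
  shows False
proof -
  have ab: "a \<notin> B1" "a \<notin> B2" "a \<notin> B3" "b \<notin> B1" "b \<notin> B2" "b \<notin> B3" using a b by auto
  obtain g1 w1 where g1: "joins g1 (p a) (p b)"
    "path_image g1 \<subseteq> drawn (insert a (insert b B1)) (theta_edges a b B1)"
    "path_image g1 \<subseteq> drawing_points V E p c" "closed (path_image g1)"
    "w1 \<in> V" "p w1 \<in> path_image g1 - {p a, p b}"
    by (rule joins_through_outer[OF a(1) b(1) \<open>a \<noteq> b\<close> ab(1,4) B1])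
  obtain g2 w2 where g2: "joins g2 (p a) (p b)"
    "path_image g2 \<subseteq> drawn (insert a (insert b B2)) (theta_edges a b B2)"
    "path_image g2 \<subseteq> drawing_points V E p c" "closed (path_image g2)"
    "w2 \<in> V" "p w2 \<in> path_image g2 - {p a, p b}"
    by (rule joins_through_outer[OF a(1) b(1) \<open>a \<noteq> b\<close> ab(2,5) B2])
  obtain g3 w3 where g3: "joins g3 (p a) (p b)"
    "path_image g3 \<subseteq> drawn (insert a (insert b B3)) (theta_edges a b B3)"
    "path_image g3 \<subseteq> drawing_points V E p c" "closed (path_image g3)"
    "w3 \<in> V" "p w3 \<in> path_image g3 - {p a, p b}"
    by (rule joins_through_outer[OF a(1) b(1) \<open>a \<noteq> b\<close> ab(3,6) B3])
  have sub: "insert a (insert b B1) \<subseteq> V" "insert a (insert b B2) \<subseteq> V" "insert a (insert b B3) \<subseteq> V"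
    using a(1) b(1) B1(1) B2(1) B3(1) by simp_all
  have i: "path_image g1 \<inter> path_image g2 = {p a, p b}" "path_image g1 \<inter> path_image g3 = {p a, p b}"
     "path_image g2 \<inter> path_image g3 = {p a, p b}"
    by (rule theta_arcs_Int[OF g1(1,2) g2(1,2) disj(1) sub(1,2)] theta_arcs_Int[OF g1(1,2) g3(1,2) disj(2) sub(1,3)]
      theta_arcs_Int[OF g2(1,2) g3(1,2) disj(3) sub(2,3)]; simp add: ab)+
  have "p w1 \<notin> inside (path_image g2 \<union> path_image g3)"
    by (intro vertex_not_inside g1 Un_least g2 g3 closed_Un)
  moreover have "p w2 \<notin> inside (path_image g1 \<union> path_image g3)"
    by (intro vertex_not_inside g1 Un_least g2 g3 closed_Un)
  moreover have "p w3 \<notin> inside (path_image g1 \<union> path_image g2)"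
    by (intro vertex_not_inside g1 Un_least g2 g3 closed_Un)
  ultimately show False
    using theta_inside[OF g1(1) g2(1) g3(1) i] g1(6) g2(6) g3(6) by (meson subsetD)
qed

lemma edge_arc_subset: "{x, y} \<in> E \<Longrightarrow> edge_arc x y \<subseteq> drawing_points V E p c"
  by (auto simp: drawing_points_def)

text \<open>The chord and the two detours form a theta curve. The detours carry the vertices
  \<open>s\<close> and \<open>t\<close>, which cannot be inside a closed curve, so the inner arc is
  the chord.\<close>

lemma chord_inside:
  assumes ne: "x \<noteq> y" "s \<noteq> t"
    and e: "{x, s} \<in> E" "{s, y} \<in> E" "{x, t} \<in> E" "{t, y} \<in> E" "{x, y} \<in> E"
  obtains g h k where
    "joins g (p x) (p y)" "path_image g = edge_arc x s \<union> edge_arc s y"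
    "joins h (p x) (p y)" "path_image h = edge_arc x t \<union> edge_arc t y"
    "joins k (p x) (p y)" "path_image k = edge_arc x y"
    "path_image g \<inter> path_image h = {p x, p y}"
    "path_image g \<inter> path_image k = {p x, p y}"
    "path_image h \<inter> path_image k = {p x, p y}"
    "path_image k - {p x, p y} \<subseteq> inside (path_image g \<union> path_image h)"
    "path_image k \<inter> inside (path_image g \<union> path_image h) \<noteq> {}"
    "p s \<notin> inside (path_image h \<union> path_image k)" "p t \<notin> inside (path_image g \<union> path_image k)"
proof -
  obtain g where g: "joins g (p x) (p y)" "path_image g = edge_arc x s \<union> edge_arc s y" using edge2_joins e ne by metis
  obtain h where h: "joins h (p x) (p y)" "path_image h = edge_arc x t \<union> edge_arc t y" using edge2_joins e ne by metis
  obtain k where k: "joins k (p x) (p y)" "path_image k = edge_arc x y" using edge_joins e by metis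
  have V: "x \<in> V" "y \<in> V" "s \<in> V" "t \<in> V" "x \<noteq> s" "x \<noteq> t" "y \<noteq> s" "y \<noteq> t"
    using e simple by (auto simp: simple_graph_def)
  have inj: "inj_on p V" using planar by (auto simp: planar_drawing_def)
  have e': "{y, s} \<in> E" "{y, t} \<in> E" "{y, x} \<in> E" "{s, x} \<in> E" "{t, x} \<in> E" using e by (simp_all add: insert_commute)
  have sym: "edge_arc s y = edge_arc y s" "edge_arc t y = edge_arc y t" "edge_arc x y = edge_arc y x" by (simp_all add: insert_commute)
  have gh: "path_image g \<inter> path_image h = {p x, p y}"
    using edge_Int[OF e(1) e(3)] edge_Int[OF e'(1,2)] edge_disjoint[OF e(1) e(4)] edge_disjoint[OF e(2) e(3)]
      ne V unfolding g(2) h(2) sym by auto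
  have gk: "path_image g \<inter> path_image k = {p x, p y}"
    using edge_Int[OF e(1) e(5)] edge_Int[OF e'(1,3)] ne V unfolding g(2) k(2) sym by auto
  have hk: "path_image h \<inter> path_image k = {p x, p y}"
    using edge_Int[OF e(3) e(5)] edge_Int[OF e'(2,3)] ne V unfolding h(2) k(2) sym by auto
  have out: "p s \<notin> inside (path_image h \<union> path_image k)" "p t \<notin> inside (path_image g \<union> path_image k)"
    using vertex_not_inside[of s "path_image h \<union> path_image k"] vertex_not_inside[of t "path_image g \<union> path_image k"]
      V(3,4) edge_arc_subset[OF e(1)] edge_arc_subset[OF e(2)] edge_arc_subset[OF e(3)] edge_arc_subset[OF e(4)] edge_arc_subset[OF e(5)]
      joinsD(8)[OF g(1)] joinsD(8)[OF h(1)] joinsD(8)[OF k(1)]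
    by (simp_all add: g(2) h(2) k(2) closed_Un)
  have "p s \<in> path_image g" "p t \<in> path_image h"
    using arc_ends(3)[OF e(1) refl] arc_ends(3)[OF e(3) refl] g(2) h(2) by auto
  moreover have "p s \<notin> {p x, p y}" "p t \<notin> {p x, p y}" using inj V by (auto simp: inj_on_def)
  ultimately have *: "path_image k - {p x, p y} \<subseteq> inside (path_image g \<union> path_image h)"
    using theta_inside[OF g(1) h(1) k(1) gh gk hk] out by blast
  \<comment> \<open>An arc has points besides its ends. The nonempty intersection obtained from this
    is the form in which the chord is used to split the inside.\<close>
  have "path_image k - {p x, p y} \<noteq> {}"
    using k(1) by (metis joins_def nonempty_simple_path_endless arc_imp_simple_path)
  then have "path_image k \<inter> inside (path_image g \<union> path_image h) \<noteq> {}" using * by blast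
  then show ?thesis using that[OF g h k gh gk hk * _ out] by blast
qed

text \<open>
  Both chords \<^term>\<open>a\<close>\<^term>\<open>b\<close> and \<^term>\<open>u\<close>\<^term>\<open>v\<close> of the 4-cycle run inside it. The first one cuts the
  inside into two regions, and the region entered by the second chord swallows \<^term>\<open>u\<close> or \<^term>\<open>v\<close>.
\<close>

lemma no_K4:
  assumes ne: "a \<noteq> b" "u \<noteq> v"
    and e: "{a, b} \<in> E" "{a, u} \<in> E" "{a, v} \<in> E" "{b, u} \<in> E" "{b, v} \<in> E" "{u, v} \<in> E"
  shows False
proof -
  have V: "a \<in> V" "b \<in> V" "u \<in> V" "v \<in> V" "a \<noteq> u" "a \<noteq> v" "b \<noteq> u" "b \<noteq> v"
    using e simple by (auto simp: simple_graph_def)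
  have e': "{u, a} \<in> E" "{u, b} \<in> E" "{v, a} \<in> E" "{v, b} \<in> E" "{v, u} \<in> E"
    using e by (simp_all add: insert_commute)
  have sym: "edge_arc u a = edge_arc a u" "edge_arc v a = edge_arc a v" "edge_arc u b = edge_arc b u" "edge_arc v b = edge_arc b v" "edge_arc v u = edge_arc u v"
    by (simp_all add: insert_commute)
  have inj: "inj_on p V" using planar by (auto simp: planar_drawing_def)
  obtain g h k where g: "joins g (p a) (p b)" "path_image g = edge_arc a u \<union> edge_arc u b"
    and h: "joins h (p a) (p b)" "path_image h = edge_arc a v \<union> edge_arc v b"
    and k: "joins k (p a) (p b)" "path_image k = edge_arc a b"
    and gh: "path_image g \<inter> path_image h = {p a, p b}"
    and gk: "path_image g \<inter> path_image k = {p a, p b}"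
    and hk: "path_image h \<inter> path_image k = {p a, p b}"
    and km: "path_image k \<inter> inside (path_image g \<union> path_image h) \<noteq> {}"
    and out: "p u \<notin> inside (path_image h \<union> path_image k)" "p v \<notin> inside (path_image g \<union> path_image k)"
    using chord_inside[of a b u v] ne e e' by metis
  obtain g' h' l where g': "path_image g' = edge_arc u a \<union> edge_arc a v" and h': "path_image h' = edge_arc u b \<union> edge_arc b v"
    and l: "joins l (p u) (p v)" "path_image l = edge_arc u v"
    and lm: "path_image l \<inter> inside (path_image g' \<union> path_image h') \<noteq> {}"
    using chord_inside[of u v a b] ne e e' by metis
  \<comment> \<open>Both applications concern the same 4-cycle, cut at \<open>a\<close>,
    \<open>b\<close> the first time and at \<open>u\<close>, \<open>v\<close> the second
    time.\<close>
  have "path_image g' \<union> path_image h' = path_image g \<union> path_image h"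
    unfolding g h g' h' sym by blast
  then obtain z where z: "z \<in> path_image l" "z \<in> inside (path_image g \<union> path_image h)"
    using lm by auto
  have lk: "path_image l \<inter> path_image k = {}"
    using edge_disjoint[OF e(6,1)] V l k by auto
  have lg: "path_image l \<inter> path_image g = {p u}"
    using edge_Int[OF e(6) e'(1)] edge_Int[OF e(6) e'(2)] V unfolding l g sym by auto
  have lh: "path_image l \<inter> path_image h = {p v}"
    using edge_Int[OF e'(5) e'(3)] edge_Int[OF e'(5) e'(4)] V unfolding l h sym by auto
  have simple_paths: "simple_path g" "simple_path h" "simple_path k"
    using g h k by (auto simp: joins_def arc_imp_simple_path)
  have "inside (path_image g \<union> path_image k) \<union> inside (path_image h \<union> path_image k) \<union>
      (path_image k - {p a, p b}) = inside (path_image g \<union> path_image h)"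
    by (rule split_inside_simple_closed_curve[OF simple_paths(1) joinsD(2,3)[OF g(1)] simple_paths(2) joinsD(2,3)[OF h(1)]
      simple_paths(3) joinsD(2,3)[OF k(1)] joinsD(6)[OF g(1)] gh gk hk km])
  then consider "z \<in> inside (path_image g \<union> path_image k)" | "z \<in> inside (path_image h \<union> path_image k)"
    using z lk by blast
  moreover have puv: "p u \<noteq> p v" using inj V ne by (auto simp: inj_on_def)
  ultimately show False
  proof cases
    case 1
    \<comment> \<open>The arc \<open>l\<close> meets the boundary of this region only at
      \<open>p u\<close>, so the rest of it, with its end \<open>p v\<close>, stays in the region.
      The other case is the mirror image, with \<open>l\<close> reversed.\<close>
    then have "z \<noteq> p u" using lg inside_no_overlap[of "path_image g \<union> path_image k"] by blast
    moreover have "(path_image l - {p u}) \<inter> (path_image g \<union> path_image k) = {}"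
      using lg lk by blast
    ultimately have "path_image l - {p u} \<subseteq> inside (path_image g \<union> path_image k)"
      using connected_subset_inside[OF connected_half_open_arc[OF l(1)]] z(1) 1 by blast
    moreover have "p v \<in> path_image l - {p u}" using joinsD(5)[OF l(1)] puv by simp
    ultimately show False using out(2) by (meson subsetD)
  next
    case 2
    then have "z \<noteq> p v" using lh inside_no_overlap[of "path_image h \<union> path_image k"] by blast
    moreover have "(path_image l - {p v}) \<inter> (path_image h \<union> path_image k) = {}"
      using lh lk by blast
    ultimately have "path_image l - {p v} \<subseteq> inside (path_image h \<union> path_image k)"
      using connected_subset_inside[OF connected_half_open_arc[OF joins_reverse[OF l(1)]]] z(1) 2 by simp
    moreover have "p u \<in> path_image l - {p v}" using joinsD(4)[OF l(1)] puv by simp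
    ultimately show False using out(1) by (meson subsetD)
  qed
qed

end

section \<open>Connected sets and minors\<close>

lemma touch_sym: "touch E A B \<longleftrightarrow> touch E B A"
  unfolding touch_def by (metis insert_commute)

lemma touch_mono: "\<lbrakk>touch E A B; A \<subseteq> A'; B \<subseteq> B'\<rbrakk> \<Longrightarrow> touch E A' B'"
  unfolding touch_def by blast

lemma touchI: "\<lbrakk>{a, b} \<in> E; a \<in> A; b \<in> B\<rbrakk> \<Longrightarrow> touch E A B"
  unfolding touch_def by blast

lemma conn_nonempty: "conn E S \<Longrightarrow> S \<noteq> {}"
  by (simp add: conn_def)

lemma conn_touch: "\<lbrakk>conn E S; A \<subseteq> S; A \<noteq> {}; A \<noteq> S\<rbrakk> \<Longrightarrow> touch E A (S - A)"
  by (simp add: conn_def)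

lemma conn_Un:
  assumes "conn E S" "conn E T" "S \<inter> T \<noteq> {} \<or> touch E S T"
  shows "conn E (S \<union> T)"
  unfolding conn_def
proof (intro conjI allI impI)
  show "S \<union> T \<noteq> {}" using conn_nonempty[OF assms(1)] by blast
  fix A assume A: "A \<subseteq> S \<union> T \<and> A \<noteq> {} \<and> A \<noteq> S \<union> T"
  consider "A \<inter> S \<noteq> {}" "A \<inter> S \<noteq> S" | "A \<inter> T \<noteq> {}" "A \<inter> T \<noteq> T"
    | "S \<subseteq> A" "A \<inter> T = {}" | "T \<subseteq> A" "A \<inter> S = {}"
    using A by blast
  then show "touch E A (S \<union> T - A)"
  proof cases
    case 1
    then have "touch E (A \<inter> S) (S - A \<inter> S)" using conn_touch[OF assms(1)] by blast
    then show ?thesis by (rule touch_mono) blast+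
  next
    case 2
    then have "touch E (A \<inter> T) (T - A \<inter> T)" using conn_touch[OF assms(2)] by blast
    then show ?thesis by (rule touch_mono) blast+
  next
    case 3
    then have "touch E S T" using assms(3) by blast
    then show ?thesis by (rule touch_mono) (use 3 in blast)+
  next
    case 4
    then have "touch E T S" using assms(3) touch_sym[of E S T] by blast
    then show ?thesis by (rule touch_mono) (use 4 in blast)+
  qed
qed

lemma conn_Union:
  assumes "F \<noteq> {}" "\<And>C. C \<in> F \<Longrightarrow> conn E C \<and> a \<in> C"
  shows "conn E (\<Union>F)"
  unfolding conn_def
proof (intro conjI allI impI)
  show "\<Union>F \<noteq> {}" using assms by blast
  fix A assume A: "A \<subseteq> \<Union>F \<and> A \<noteq> {} \<and> A \<noteq> \<Union>F"
  show "touch E A (\<Union>F - A)"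
  proof (cases "\<exists>C\<in>F. A \<inter> C \<noteq> {} \<and> A \<inter> C \<noteq> C")
    case True
    then obtain C where C: "C \<in> F" "A \<inter> C \<noteq> {}" "A \<inter> C \<noteq> C" by blast
    then have "touch E (A \<inter> C) (C - A \<inter> C)" using conn_touch[of E C "A \<inter> C"] assms(2) by blast
    then show ?thesis by (rule touch_mono) (use C in blast)+
  next
    case False
    then have "A = {} \<or> A = \<Union>F" using A assms(2) by (cases "a \<in> A") blast+
    then show ?thesis using A by blast
  qed
qed

section \<open>Components and the effect of deleting a vertex\<close>

definition component :: "'a set set \<Rightarrow> 'a set \<Rightarrow> 'a \<Rightarrow> 'a set" where
  "component E W a = \<Union>{C. C \<subseteq> W \<and> a \<in> C \<and> conn E C}"

definition comps :: "'a set set \<Rightarrow> 'a set \<Rightarrow> 'a set set" where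
  "comps E W = component E W ` W"

lemma component_in_comps: "a \<in> W \<Longrightarrow> component E W a \<in> comps E W"
  by (simp add: comps_def)

lemma component_self: "a \<in> W \<Longrightarrow> a \<in> component E W a"
  unfolding component_def using conn_singleton[of E a] by blast

lemma comps_subset: "C \<in> comps E W \<Longrightarrow> C \<subseteq> W"
  unfolding comps_def component_def by blast

lemma Union_comps: "\<Union>(comps E W) = W"
  using comps_subset component_self component_in_comps by fast

lemma comps_conn: "C \<in> comps E W \<Longrightarrow> conn E C"
proof -
  assume "C \<in> comps E W"
  then obtain a where a: "a \<in> W" "C = component E W a" by (auto simp: comps_def)
  have "{a} \<in> {C. C \<subseteq> W \<and> a \<in> C \<and> conn E C}" using a(1) by simp
  then have "{C. C \<subseteq> W \<and> a \<in> C \<and> conn E C} \<noteq> {}" by (metis empty_iff)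
  then show ?thesis unfolding a(2) component_def
    by (rule conn_Union[where a = a]) simp
qed

text \<open>Joining \<open>D\<close> to \<open>C\<close> gives a connected subset of
  \<open>W\<close> through the base point of \<open>C\<close>, which the component already
  contains.\<close>

lemma comps_maximal:
  assumes "C \<in> comps E W" "conn E D" "D \<subseteq> W" "C \<inter> D \<noteq> {} \<or> touch E C D"
  shows "D \<subseteq> C"
proof -
  obtain a where a: "a \<in> W" "C = component E W a" using assms(1) by (auto simp: comps_def)
  have "conn E (C \<union> D)" using conn_Un[OF comps_conn[OF assms(1)] assms(2,4)] .
  moreover have "C \<union> D \<subseteq> W" using comps_subset[OF assms(1)] assms(3) by blast
  moreover have "a \<in> C \<union> D" using component_self[OF a(1)] a(2) by blast
  ultimately have "C \<union> D \<subseteq> component E W a" unfolding component_def by blast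
  then show ?thesis using a(2) by blast
qed

lemma comps_disjoint:
  assumes "C \<in> comps E W" "D \<in> comps E W" "C \<noteq> D"
  shows "C \<inter> D = {}"
  using comps_maximal[OF assms(1) comps_conn[OF assms(2)] comps_subset[OF assms(2)]]
    comps_maximal[OF assms(2) comps_conn[OF assms(1)] comps_subset[OF assms(1)]] assms(3) by blast

lemma comps_edge:
  assumes "C \<in> comps E W" "u \<in> C" "{u, v} \<in> E" "v \<in> W"
  shows "v \<in> C"
  using comps_maximal[OF assms(1) conn_singleton[of E v]] assms touchI[of u v E C "{v}"] by blast

lemma finite_comps: "finite W \<Longrightarrow> finite (comps E W)"
  by (simp add: comps_def)

text \<open>Edges from \<open>C\<close> to the rest of \<open>K\<close> end at \<open>x\<close>.
  Hence a part of \<open>K - C\<close> without \<open>x\<close> keeps an edge leaving it that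
  \<open>K\<close> provides, and a part containing \<open>x\<close> is treated through its
  complement.\<close>

lemma conn_remove:
  assumes K: "conn E K" and x: "x \<in> K" and C: "C \<in> comps E (K - {x})"
  shows "conn E (K - C)" "touch E {x} C"
proof -
  have CK: "C \<subseteq> K - {x}" "C \<noteq> {}" using comps_subset[OF C] conn_nonempty[OF comps_conn[OF C]] by auto
  have *: "touch E A (K - C - A)" if A: "A \<subseteq> K - C" "A \<noteq> {}" "x \<notin> A" for A
  proof -
    have "A \<subseteq> K" "A \<noteq> K" using A x by auto
    then have "touch E A (K - A)" using conn_touch[OF K] A(2) by blast
    then obtain a b where ab: "a \<in> A" "b \<in> K - A" "{a, b} \<in> E" unfolding touch_def by blast
    have "b \<notin> C"
    proof
      assume "b \<in> C"
      then have "a \<in> C" using comps_edge[OF C, of b a] ab A by (auto simp: insert_commute)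
      then show False using ab(1) A(1) by blast
    qed
    then show ?thesis using ab by (intro touchI[of a b]) auto
  qed
  show "conn E (K - C)"
    unfolding conn_def
  proof (intro conjI allI impI)
    show "K - C \<noteq> {}" using x CK by blast
    fix A assume A: "A \<subseteq> K - C \<and> A \<noteq> {} \<and> A \<noteq> K - C"
    show "touch E A (K - C - A)"
    proof (cases "x \<in> A")
      case False
      then show ?thesis using *[of A] A by blast
    next
      case True
      then have "touch E (K - C - A) (K - C - (K - C - A))" using *[of "K - C - A"] A by blast
      moreover have "K - C - (K - C - A) = A" using A by blast
      ultimately show ?thesis using touch_sym[of E A] by simp
    qed
  qed
  have "touch E C (K - C)" using conn_touch[OF K, of C] CK x by blast
  then obtain a b where ab: "a \<in> C" "b \<in> K - C" "{a, b} \<in> E" unfolding touch_def by blast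
  have "b = x" using comps_edge[OF C ab(1,3)] ab(2) by blast
  then show "touch E {x} C" using ab by (auto simp: touch_def insert_commute)
qed

text \<open>\<open>Q\<close> is the component of \<open>q\<close> after deleting \<open>p\<close>,
  and \<open>P\<close> is everything else. This turns one connected set into two adjacent branch
  sets.\<close>

lemma conn_split:
  assumes "conn E S" "p \<in> S" "q \<in> S" "p \<noteq> q"
  obtains P Q where "P \<union> Q = S" "P \<inter> Q = {}" "p \<in> P" "q \<in> Q" "conn E P" "conn E Q" "touch E P Q"
proof -
  let ?Q = "component E (S - {p}) q"
  have q: "q \<in> S - {p}" using assms by blast
  then have Q: "?Q \<in> comps E (S - {p})" by (rule component_in_comps)
  have QS: "?Q \<subseteq> S - {p}" using comps_subset[OF Q] .
  have "p \<in> S - ?Q" using QS assms(2) by blast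
  moreover have "touch E (S - ?Q) ?Q"
    using conn_remove(2)[OF assms(1,2) Q] by (rule touch_mono) (use \<open>p \<in> S - ?Q\<close> in blast)+
  ultimately show ?thesis
    using that[of "S - ?Q" ?Q] QS component_self[OF q] conn_remove(1)[OF assms(1,2) Q] comps_conn[OF Q] by blast
qed

section \<open>Branch sets of K_{2,3} and K_4 and their reduction to vertices\<close>

definition K23_minor :: "'a set set \<Rightarrow> bool" where
  "K23_minor E \<longleftrightarrow> (\<exists>A A' B. conn E A \<and> conn E A' \<and> A \<inter> A' = {} \<and>
     (\<forall>i<3::nat. conn E (B i) \<and> A \<inter> B i = {} \<and> A' \<inter> B i = {} \<and> touch E A (B i) \<and> touch E A' (B i)) \<and>
     (\<forall>i<3. \<forall>j<3. i \<noteq> j \<longrightarrow> B i \<inter> B j = {}))"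

lemma less_3_cases: "(i::nat) < 3 \<longleftrightarrow> i = 0 \<or> i = 1 \<or> i = 2"
  by auto

lemma K23_minorI:
  assumes "conn E A" "conn E A'" "A \<inter> A' = {}"
    "conn E B0" "A \<inter> B0 = {}" "A' \<inter> B0 = {}" "touch E A B0" "touch E A' B0"
    "conn E B1" "A \<inter> B1 = {}" "A' \<inter> B1 = {}" "touch E A B1" "touch E A' B1"
    "conn E B2" "A \<inter> B2 = {}" "A' \<inter> B2 = {}" "touch E A B2" "touch E A' B2"
    "B0 \<inter> B1 = {}" "B0 \<inter> B2 = {}" "B1 \<inter> B2 = {}"
  shows "K23_minor E"
  unfolding K23_minor_def
proof (intro exI conjI)
  let ?B = "\<lambda>i::nat. if i = 0 then B0 else if i = 1 then B1 else B2"
  show "\<forall>i<3. conn E (?B i) \<and> A \<inter> ?B i = {} \<and> A' \<inter> ?B i = {} \<and> touch E A (?B i) \<and> touch E A' (?B i)"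
    using assms by simp
  show "\<forall>i<3. \<forall>j<3. i \<noteq> j \<longrightarrow> ?B i \<inter> ?B j = {}"
    using assms by (simp add: less_3_cases Int_commute)
qed (use assms in blast)+

lemma two_of_three:
  fixes R :: "nat \<Rightarrow> bool"
  assumes "\<And>i. i < 3 \<Longrightarrow> R i \<or> R' i"
  shows "\<exists>k<3. (\<forall>i<3. i \<noteq> k \<longrightarrow> R i) \<or> (\<forall>i<3. i \<noteq> k \<longrightarrow> R' i)"
proof -
  have "R 0 \<or> R' 0" "R 1 \<or> R' 1" "R 2 \<or> R' 2" using assms[of 0] assms[of 1] assms[of 2] by auto
  then have "(R 0 \<and> R 1 \<or> R' 0 \<and> R' 1) \<or> (R 0 \<and> R 2 \<or> R' 0 \<and> R' 2) \<or> (R 1 \<and> R 2 \<or> R' 1 \<and> R' 2)"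
    by blast
  then show ?thesis
  proof (elim disjE)
    assume "R 0 \<and> R 1" then show ?thesis by (intro exI[of _ 2]) (auto simp: less_3_cases)
  next
    assume "R' 0 \<and> R' 1" then show ?thesis by (intro exI[of _ 2]) (auto simp: less_3_cases)
  next
    assume "R 0 \<and> R 2" then show ?thesis by (intro exI[of _ 1]) (auto simp: less_3_cases)
  next
    assume "R' 0 \<and> R' 2" then show ?thesis by (intro exI[of _ 1]) (auto simp: less_3_cases)
  next
    assume "R 1 \<and> R 2" then show ?thesis by (intro exI[of _ 0]) (auto simp: less_3_cases)
  next
    assume "R' 1 \<and> R' 2" then show ?thesis by (intro exI[of _ 0]) (auto simp: less_3_cases)
  qed
qed

lemma conn_cases_split:
  assumes "conn E A"
  obtains a where "A = {a}" | P Q where "P \<union> Q = A" "P \<inter> Q = {}" "P \<noteq> {}" "Q \<noteq> {}"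
    "conn E P" "conn E Q" "touch E P Q"
proof (cases "\<exists>a. A = {a}")
  case False
  obtain a where "a \<in> A" using conn_nonempty[OF assms] by blast
  moreover obtain b where "b \<in> A" "b \<noteq> a" using False \<open>a \<in> A\<close> by blast
  ultimately obtain P Q where "P \<union> Q = A" "P \<inter> Q = {}" "a \<in> P" "b \<in> Q" "conn E P" "conn E Q" "touch E P Q"
    using conn_split[OF assms] by metis
  then show ?thesis using that(2)[of P Q] by blast
qed (use that in blast)

text \<open>A hub with several vertices splits into two adjacent connected halves. By pigeonhole one
  half touches at least two of the branches; it remains as the hub, and the third branch may absorb
  the other half. The upper bound on \<open>C i\<close> keeps the branches away from the second hub,
  to which the lemma is applied afterwards.\<close>

lemma singleton_hub:
  fixes B :: "nat \<Rightarrow> 'a set"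
  assumes "finite A" "conn E A" "\<forall>i<3. conn E (B i) \<and> A \<inter> B i = {} \<and> touch E A (B i)"
    "\<forall>i<3. \<forall>j<3. i \<noteq> j \<longrightarrow> B i \<inter> B j = {}"
  shows "\<exists>a\<in>A. \<exists>C. (\<forall>i<3. conn E (C i) \<and> touch E {a} (C i) \<and> B i \<subseteq> C i \<and> C i \<subseteq> B i \<union> (A - {a})) \<and>
    (\<forall>i<3. \<forall>j<3. i \<noteq> j \<longrightarrow> C i \<inter> C j = {})"
  using assms
proof (induction "card A" arbitrary: A B rule: less_induct)
  case less
  from conn_cases_split[OF less.prems(2)] show ?case
  proof cases
    case (1 a)
    then show ?thesis using less.prems by (intro bexI[of _ a] exI[of _ B]) auto
  next
    case (2 P Q)
    have step: ?thesis if PQ: "P \<union> Q = A" "P \<inter> Q = {}" "Q \<noteq> {}" "conn E P" "conn E Q" "touch E P Q"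
      and k: "k < 3" "\<forall>i<3. i \<noteq> k \<longrightarrow> touch E P (B i)" for P Q k
    proof -
      have PA: "P \<subset> A" using PQ by blast
      then have c: "card P < card A" "finite P"
        using less.prems(1) by (auto intro: psubset_card_mono finite_subset)
      \<comment> \<open>If \<open>P\<close> touches all three branches, \<open>Q\<close> is dropped.
        Otherwise the contact of \<open>A\<close> with \<open>B k\<close> is through
        \<open>Q\<close>, so \<open>B k\<close> and \<open>Q\<close> merge into a branch that
        touches \<open>P\<close>.\<close>
      define B' where "B' = (if touch E P (B k) then B else B(k := B k \<union> Q))"
      have "\<forall>i<3. conn E (B' i) \<and> P \<inter> B' i = {} \<and> touch E P (B' i) \<and> B i \<subseteq> B' i \<and> B' i \<subseteq> B i \<union> Q"
      proof (cases "touch E P (B k)")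
        case True
        then show ?thesis using k PQ(1) less.prems(3) unfolding B'_def by auto
      next
        case False
        have "touch E A (B k)" using less.prems(3) k(1) by blast
        then have "touch E Q (B k)" using False PQ(1) unfolding touch_def by blast
        then have "conn E (B k \<union> Q)" using conn_Un[of E "B k" Q] PQ(5) less.prems(3) k(1) touch_sym[of E] by blast
        moreover have "touch E P (B k \<union> Q)" using PQ(6) by (rule touch_mono) auto
        moreover have "P \<inter> (B k \<union> Q) = {}" using PQ less.prems(3) k(1) by blast
        ultimately show ?thesis using k less.prems(3) PQ(1) False unfolding B'_def by auto
      qed note B' = this
      moreover have "B' i \<inter> B' j = {}" if "i < 3" "j < 3" "i \<noteq> j" for i j
      proof -
        have "B i \<inter> B j = {}" "Q \<inter> B i = {}" "Q \<inter> B j = {}" using less.prems(3,4) that PQ(1) by blast+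
        then show ?thesis using that unfolding B'_def by auto
      qed
      ultimately obtain a C where C: "a \<in> P" "\<forall>i<3. conn E (C i) \<and> touch E {a} (C i) \<and> B' i \<subseteq> C i \<and> C i \<subseteq> B' i \<union> (P - {a})"
        "\<forall>i<3. \<forall>j<3. i \<noteq> j \<longrightarrow> C i \<inter> C j = {}"
        using less.hyps[OF c PQ(4), of B'] by blast
      have "B i \<subseteq> C i \<and> C i \<subseteq> B i \<union> (A - {a})" if "i < 3" for i
      proof -
        have "B i \<subseteq> B' i" "B' i \<subseteq> B i \<union> Q" using B' that by auto
        moreover have "B' i \<subseteq> C i" "C i \<subseteq> B' i \<union> (P - {a})" using C(2) that by auto
        ultimately show ?thesis using PQ(1,2) C(1) by blast
      qed
      then show ?thesis using C PQ(1) by (intro bexI[of _ a] exI[of _ C]) auto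
    qed
    have "touch E P (B i) \<or> touch E Q (B i)" if "i < 3" for i
    proof -
      have "touch E A (B i)" using less.prems(3) that by blast
      then show ?thesis using 2(1) unfolding touch_def by blast
    qed
    then obtain k where k: "k < 3" "(\<forall>i<3. i \<noteq> k \<longrightarrow> touch E P (B i)) \<or> (\<forall>i<3. i \<noteq> k \<longrightarrow> touch E Q (B i))"
      using two_of_three[of "\<lambda>i. touch E P (B i)" "\<lambda>i. touch E Q (B i)"] by blast
    have QP: "Q \<union> P = A" "Q \<inter> P = {}" "touch E Q P"
      using 2 touch_sym[of E P Q] by (simp_all add: Un_commute Int_commute)
    from k(2) show ?thesis
    proof
      assume "\<forall>i<3. i \<noteq> k \<longrightarrow> touch E P (B i)"
      then show ?thesis by (rule step[OF 2(1,2,4,5,6,7) k(1)])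
    next
      assume "\<forall>i<3. i \<noteq> k \<longrightarrow> touch E Q (B i)"
      then show ?thesis by (rule step[OF QP(1,2) 2(3,6,5) QP(3) k(1)])
    qed
  qed
qed

text \<open>The same descent with fixed branches. If the retained half \<open>P\<close> misses
  \<open>B k\<close>, then \<open>Q\<close> touches it, and \<open>P\<close> and \<open>B k\<close>
  are the hubs of a K_{2,3} minor with branches \<open>Q\<close> and the two remaining
  \<open>B i\<close>, \<open>B j\<close>.\<close>

lemma K4_shrink_to_vertex_family:
  fixes B :: "nat \<Rightarrow> 'a set"
  assumes "finite A" "conn E A" "\<forall>i<3. conn E (B i) \<and> A \<inter> B i = {} \<and> touch E A (B i)"
    "\<forall>i<3. \<forall>j<3. i \<noteq> j \<longrightarrow> B i \<inter> B j = {} \<and> touch E (B i) (B j)" "\<not> K23_minor E"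
  shows "\<exists>a\<in>A. \<forall>i<3. touch E {a} (B i)"
  using assms(1-3)
proof (induction "card A" arbitrary: A rule: less_induct)
  case less
  from conn_cases_split[OF less.prems(2)] show ?case
  proof cases
    case (1 a)
    then show ?thesis using less.prems by auto
  next
    case (2 P Q)
    have step: ?thesis if PQ: "P \<union> Q = A" "P \<inter> Q = {}" "Q \<noteq> {}" "conn E P" "conn E Q" "touch E P Q"
      and k: "k < 3" "\<forall>i<3. i \<noteq> k \<longrightarrow> touch E P (B i)" for P Q k
    proof (cases "touch E P (B k)")
      case True
      have PA: "P \<subset> A" using PQ by blast
      then have c: "card P < card A" "finite P"
        using less.prems(1) by (auto intro: psubset_card_mono finite_subset)
      have "\<forall>i<3. conn E (B i) \<and> P \<inter> B i = {} \<and> touch E P (B i)"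
        using True k PA less.prems(3) by blast
      then show ?thesis using less.hyps[OF c PQ(4)] PA by blast
    next
      case False
      have "touch E A (B k)" using less.prems(3) k(1) by blast
      then have "touch E Q (B k)" using False PQ(1) unfolding touch_def by blast
      moreover obtain i j where ij: "i < 3" "j < 3" "i \<noteq> j" "i \<noteq> k" "j \<noteq> k"
      proof -
        have "\<exists>i j. i < 3 \<and> j < 3 \<and> i \<noteq> j \<and> i \<noteq> k \<and> j \<noteq> k"
          using k(1) unfolding less_3_cases by (metis One_nat_def n_not_Suc_n numeral_2_eq_2 nat.distinct(1))
        then show ?thesis using that by blast
      qed
      moreover have "A \<inter> B k = {}" "A \<inter> B i = {}" "A \<inter> B j = {}" "conn E (B k)" "conn E (B i)" "conn E (B j)"
        using less.prems(3) ij k(1) by auto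
      moreover have "B k \<inter> B i = {}" "B k \<inter> B j = {}" "B i \<inter> B j = {}" "touch E (B k) (B i)" "touch E (B k) (B j)"
        using assms(4) ij k(1) by auto
      ultimately have "K23_minor E"
        using PQ k(2) touch_sym[of E Q "B k"]
        by (intro K23_minorI[of E P "B k" Q "B i" "B j"]) blast+
      then show ?thesis using assms(5) by blast
    qed
    have "touch E P (B i) \<or> touch E Q (B i)" if "i < 3" for i
    proof -
      have "touch E A (B i)" using less.prems(3) that by blast
      then show ?thesis using 2(1) unfolding touch_def by blast
    qed
    then obtain k where k: "k < 3" "(\<forall>i<3. i \<noteq> k \<longrightarrow> touch E P (B i)) \<or> (\<forall>i<3. i \<noteq> k \<longrightarrow> touch E Q (B i))"
      using two_of_three[of "\<lambda>i. touch E P (B i)" "\<lambda>i. touch E Q (B i)"] by blast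
    have QP: "Q \<union> P = A" "Q \<inter> P = {}" "touch E Q P"
      using 2 touch_sym[of E P Q] by (simp_all add: Un_commute Int_commute)
    from k(2) show ?thesis
    proof
      assume "\<forall>i<3. i \<noteq> k \<longrightarrow> touch E P (B i)"
      then show ?thesis by (rule step[OF 2(1,2,4,5,6,7) k(1)])
    next
      assume "\<forall>i<3. i \<noteq> k \<longrightarrow> touch E Q (B i)"
      then show ?thesis by (rule step[OF QP(1,2) 2(3,6,5) QP(3) k(1)])
    qed
  qed
qed

lemma K4_shrink_to_vertex:
  assumes "finite A" "conn E A" "\<not> K23_minor E"
    "conn E B0" "A \<inter> B0 = {}" "touch E A B0" "conn E B1" "A \<inter> B1 = {}" "touch E A B1"
    "conn E B2" "A \<inter> B2 = {}" "touch E A B2" "B0 \<inter> B1 = {}" "B0 \<inter> B2 = {}" "B1 \<inter> B2 = {}"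
    "touch E B0 B1" "touch E B0 B2" "touch E B1 B2"
  obtains a where "a \<in> A" "touch E {a} B0" "touch E {a} B1" "touch E {a} B2"
proof -
  let ?B = "\<lambda>i::nat. if i = 0 then B0 else if i = 1 then B1 else B2"
  have "\<forall>i<3. conn E (?B i) \<and> A \<inter> ?B i = {} \<and> touch E A (?B i)"
    using assms by simp
  moreover have "touch E B1 B0" "touch E B2 B0" "touch E B2 B1" "B1 \<inter> B0 = {}" "B2 \<inter> B0 = {}" "B2 \<inter> B1 = {}"
    using assms(13-18) touch_sym[of E] by blast+
  then have "\<forall>i<3. \<forall>j<3. i \<noteq> j \<longrightarrow> ?B i \<inter> ?B j = {} \<and> touch E (?B i) (?B j)"
    using assms(13-18) by (simp add: less_3_cases)
  ultimately obtain a where "a \<in> A" and a: "\<forall>i<3. touch E {a} (?B i)"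
    using K4_shrink_to_vertex_family[OF assms(1,2) _ _ assms(3), of ?B] by blast
  have "touch E {a} B0" "touch E {a} B1" "touch E {a} B2"
    using a[rule_format, of 0] a[rule_format, of 1] a[rule_format, of 2] by simp_all
  then show ?thesis using that \<open>a \<in> A\<close> by blast
qed

lemma touch_singletons [simp]: "touch E {a} {b} \<longleftrightarrow> {a, b} \<in> E"
  by (simp add: touch_def)

definition K4_subgraph :: "'a set set \<Rightarrow> bool" where
  "K4_subgraph E \<longleftrightarrow> (\<exists>a b u v. a \<noteq> b \<and> u \<noteq> v \<and>
     {a, b} \<in> E \<and> {a, u} \<in> E \<and> {a, v} \<in> E \<and> {b, u} \<in> E \<and> {b, v} \<in> E \<and> {u, v} \<in> E)"

text \<open>The branch sets are shrunk one after the other. Vertices already chosen act as singleton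
  branch sets in the later rounds.\<close>

lemma K4_minor_imp_subgraph:
  assumes no: "\<not> K23_minor E"
    and fin: "finite A" "finite B" "finite C" "finite D"
    and conn: "conn E A" "conn E B" "conn E C" "conn E D"
    and disj: "A \<inter> B = {}" "A \<inter> C = {}" "A \<inter> D = {}" "B \<inter> C = {}" "B \<inter> D = {}" "C \<inter> D = {}"
    and t: "touch E A B" "touch E A C" "touch E A D" "touch E B C" "touch E B D" "touch E C D"
  shows "K4_subgraph E"
proof -
  note sym = touch_sym[of E]
  obtain a where a: "a \<in> A" "touch E {a} B" "touch E {a} C" "touch E {a} D"
    by (rule K4_shrink_to_vertex[OF fin(1) conn(1) no conn(2) disj(1) t(1) conn(3) disj(2) t(2) conn(4) disj(3) t(3)
      disj(4-6) t(4-6)])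
  have Ba: "B \<inter> {a} = {}" "{a} \<inter> C = {}" "{a} \<inter> D = {}" "touch E B {a}" using a disj sym by blast+
  obtain b where b: "b \<in> B" "touch E {b} {a}" "touch E {b} C" "touch E {b} D"
    by (rule K4_shrink_to_vertex[OF fin(2) conn(2) no conn_singleton Ba(1,4) conn(3) disj(4) t(4) conn(4) disj(5) t(5)
      Ba(2,3) disj(6) a(3,4) t(6)])
  have Cb: "C \<inter> {a} = {}" "touch E C {a}" "C \<inter> {b} = {}" "touch E C {b}"
      "{a} \<inter> {b} = {}" "{a} \<inter> D = {}" "{b} \<inter> D = {}" "touch E {a} {b}"
    using a b disj sym by blast+
  obtain c where c: "c \<in> C" "touch E {c} {a}" "touch E {c} {b}" "touch E {c} D"
    by (rule K4_shrink_to_vertex[OF fin(3) conn(3) no conn_singleton Cb(1,2) conn_singleton Cb(3,4) conn(4) disj(6) t(6)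
      Cb(5-8) a(4) b(4)])
  have Dc: "D \<inter> {a} = {}" "touch E D {a}" "D \<inter> {b} = {}" "touch E D {b}" "D \<inter> {c} = {}" "touch E D {c}"
      "{a} \<inter> {b} = {}" "{a} \<inter> {c} = {}" "{b} \<inter> {c} = {}"
      "touch E {a} {b}" "touch E {a} {c}" "touch E {b} {c}"
    using a b c disj sym by blast+
  obtain d where d: "d \<in> D" "touch E {d} {a}" "touch E {d} {b}" "touch E {d} {c}"
    by (rule K4_shrink_to_vertex[OF fin(4) conn(4) no conn_singleton Dc(1,2) conn_singleton Dc(3,4) conn_singleton Dc(5-12)])
  have "a \<noteq> b" "c \<noteq> d" using a b c d disj by blast+
  moreover have "{a, b} \<in> E" "{a, c} \<in> E" "{a, d} \<in> E" "{b, c} \<in> E" "{b, d} \<in> E" "{c, d} \<in> E"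
    using b(2) c(2,3) d(2-4) by (simp_all add: insert_commute)
  ultimately show ?thesis unfolding K4_subgraph_def by blast
qed

text \<open>
  Among the neighbors \<^term>\<open>x\<close> of \<^term>\<open>q\<close> with a component \<^term>\<open>C\<close> of \<^term>\<open>K - {x}\<close> that touches both
  terminals, choose one with \<^term>\<open>C\<close> smallest. A neighbor of \<^term>\<open>q\<close> in \<^term>\<open>C\<close> does not separate
  either, and by minimality its bad component contains \<^term>\<open>x\<close>; this produces a $K_4$ or $K_{2,3}$ minor.
\<close>

lemma separating_vertex:
  assumes no: "\<not> K23_minor E" "\<not> K4_subgraph E" and fin: "finite K" "finite S"
    and K: "conn E K" and S: "conn E S" "p \<in> S" "q \<in> S" "S \<inter> K = {}" and "p \<noteq> q"
    and pq: "touch E {p} K" "touch E {q} K"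
  shows "\<exists>x\<in>K. \<forall>C\<in>comps E (K - {x}). \<not> (touch E {p} C \<and> touch E {q} C)"
proof (rule ccontr)
  assume contra: "\<not> ?thesis"
  obtain P Q where PQ: "P \<union> Q = S" "P \<inter> Q = {}" "p \<in> P" "q \<in> Q" "conn E P" "conn E Q" "touch E P Q"
    using conn_split[OF S(1-3) \<open>p \<noteq> q\<close>] by metis
  define bad where "bad = (\<lambda>(x, C). x \<in> K \<and> {q, x} \<in> E \<and> C \<in> comps E (K - {x}) \<and> touch E {p} C \<and> touch E {q} C)"
  have ex: "\<exists>C. bad (x, C)" if "x \<in> K" "{q, x} \<in> E" for x
    using contra that unfolding bad_def by auto
  obtain x0 where "x0 \<in> K" "{q, x0} \<in> E" using pq(2) by (auto simp: touch_def)
  then have "\<exists>z. bad z" using ex by blast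
  then obtain z where z: "bad z" "\<And>y. bad y \<Longrightarrow> card (snd z) \<le> card (snd y)"
    using ex_has_least_nat[of bad _ "\<lambda>z. card (snd z)"] by blast
  obtain x C where "z = (x, C)" by (cases z)
  with z have x: "x \<in> K" "{q, x} \<in> E" and C: "C \<in> comps E (K - {x})" "touch E {p} C" "touch E {q} C"
    and least: "\<And>y D. bad (y, D) \<Longrightarrow> card C \<le> card D"
    by (auto simp: bad_def)
  have CK: "C \<subseteq> K - {x}" and cC: "conn E C" using comps_subset comps_conn C(1) by blast+
  have cKC: "conn E (K - C)" "touch E {x} C" using conn_remove[OF K x(1) C(1)] by blast+
  obtain x' where x': "x' \<in> C" "{q, x'} \<in> E" using C(3) by (auto simp: touch_def)
  then obtain C1 where "bad (x', C1)" using ex[of x'] CK by blast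
  then have C1: "C1 \<in> comps E (K - {x'})" "touch E {p} C1" and le: "card C \<le> card C1"
    using least by (auto simp: bad_def)
  have C1K: "C1 \<subseteq> K - {x'}" and cC1: "conn E C1" using comps_subset comps_conn C1(1) by blast+
  have KC_sub: "K - C \<subseteq> K - {x'}" using x' by blast
  \<comment> \<open>Without \<open>x\<close>, the component \<open>C1\<close> would avoid the whole
    connected set \<open>K - C\<close> and lie in \<open>C\<close> without \<open>x'\<close>,
    contradicting the choice of the smallest \<open>C\<close>.\<close>
  have xC1: "x \<in> C1"
  proof (rule ccontr)
    assume "x \<notin> C1"
    then have "C1 \<inter> (K - C) = {}" using comps_maximal[OF C1(1) cKC(1) KC_sub] x(1) CK by blast
    then have "C1 \<subset> C" using C1K x'(1) by blast
    moreover have "finite C" using CK fin(1) finite_subset by blast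
    ultimately show False using le psubset_card_mono[of C C1] by simp
  qed
  obtain y where y: "y \<in> C1" "{p, y} \<in> E" using C1(2) by (auto simp: touch_def)
  have finPQ: "finite P" "finite Q" "finite C" "finite (K - C)" using fin PQ(1) CK finite_subset by blast+
  show False
  proof (cases "y \<in> C")
    case False
    \<comment> \<open>If \<open>p\<close> has a neighbor in \<open>K - C\<close>, then
      \<open>P\<close>, \<open>Q\<close>, \<open>C\<close> and \<open>K - C\<close> touch pairwise
      and form a K_4 minor.\<close>
    have xKC: "x \<in> K - C" using x(1) CK by blast
    have "touch E P (K - C)" using touchI[OF y(2) PQ(3), of "K - C"] y(1) C1K False by blast
    moreover have "touch E P C" by (rule touch_mono[OF C(2)]) (simp_all add: PQ(3))
    moreover have "touch E Q (K - C)" by (rule touchI[OF x(2) PQ(4) xKC])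
    moreover have "touch E Q C" by (rule touch_mono[OF C(3)]) (simp_all add: PQ(4))
    moreover have "touch E (K - C) C" by (rule touch_mono[OF cKC(2)]) (use xKC in simp_all)
    moreover have "P \<inter> (K - C) = {}" "P \<inter> C = {}" "Q \<inter> (K - C) = {}" "Q \<inter> C = {}" "(K - C) \<inter> C = {}"
      using S(4) PQ(1) CK by auto
    ultimately have "K4_subgraph E"
      by (intro K4_minor_imp_subgraph[OF no(1) finPQ(1,2,4,3) PQ(5,6) cKC(1) cC PQ(2) _ _ _ _ _ PQ(7)])
    then show False using no by blast
  next
    case True
    \<comment> \<open>If the neighbor \<open>y\<close> of \<open>p\<close> lies in \<open>C\<close>,
      its component \<open>M\<close> of \<open>C - {x'}\<close> touches \<open>P\<close>,
      \<open>x'\<close> and, as shown below, \<open>x\<close>. So does \<open>Q\<close>, which gives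
      a K_{2,3} minor with hubs \<open>Q\<close> and \<open>M\<close>.\<close>
    define M where "M = component E (C - {x'}) y"
    have yC: "y \<in> C - {x'}" using True y C1K by blast
    have M: "M \<in> comps E (C - {x'})" "y \<in> M" using component_in_comps[OF yC, of E] component_self[OF yC, of E] by (simp_all add: M_def)
    have MC: "M \<subseteq> C - {x'}" and cM: "conn E M" using comps_subset[OF M(1)] comps_conn[OF M(1)] .
    have x'M: "touch E {x'} M" using conn_remove(2)[OF cC x'(1) M(1)] .
    have MC1: "M \<subseteq> C1"
    proof (rule comps_maximal[OF C1(1) cM])
      show "M \<subseteq> K - {x'}" "C1 \<inter> M \<noteq> {} \<or> touch E C1 M" using MC CK M(2) y(1) by auto
    qed
    have xM: "x \<notin> M" using MC CK by blast
    have "touch E M (C1 - M)" using conn_touch[OF cC1 MC1] xC1 xM M(2) by blast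
    then obtain m w where mw: "m \<in> M" "w \<in> C1 - M" "{m, w} \<in> E" unfolding touch_def by blast
    \<comment> \<open>\<open>M\<close> has an edge to another vertex of \<open>C1\<close>, which
      avoids \<open>x'\<close>. Unless this vertex is \<open>x\<close>, it stays in
      \<open>C - {x'}\<close> and hence in \<open>M\<close>.\<close>
    have "w = x"
    proof (rule ccontr)
      assume "w \<noteq> x"
      then have "w \<in> K - {x}" using mw(2) C1K by blast
      then have "w \<in> C" using comps_edge[OF C(1), of m w] mw MC by blast
      then have "w \<in> C - {x'}" using mw(2) C1K by blast
      then show False using comps_edge[OF M(1) mw(1,3)] mw(2) by blast
    qed
    then have Mx: "touch E M {x}" using touchI[OF mw(3,1)] by simp
    have xx': "x \<noteq> x'" using x' CK by blast
    have "touch E M {x'}" using x'M by (simp add: touch_sym[of E M])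
    moreover have "touch E Q {x}" "touch E Q {x'}"
      using touchI[OF x(2) PQ(4)] touchI[OF x'(2) PQ(4)] by simp_all
    moreover have "touch E Q P" using PQ(7) by (simp add: touch_sym[of E Q])
    moreover have "touch E M P" using touchI[OF y(2) PQ(3) M(2)] by (simp add: touch_sym[of E M])
    moreover have PK: "P \<inter> K = {}" "Q \<inter> K = {}" "M \<subseteq> K" "x' \<in> K" using S(4) PQ(1) MC CK x'(1) by auto
    then have "Q \<inter> M = {}" "Q \<inter> {x} = {}" "Q \<inter> {x'} = {}" "M \<inter> P = {}" "{x} \<inter> P = {}" "{x'} \<inter> P = {}"
      using x(1) by auto
    moreover have "Q \<inter> P = {}" "M \<inter> {x} = {}" "M \<inter> {x'} = {}" "{x} \<inter> {x'} = {}"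
      using PQ(2) MC xM xx' by auto
    ultimately have "K23_minor E"
      by (intro K23_minorI[OF PQ(6) cM _ conn_singleton _ _ _ Mx conn_singleton _ _ _ _ PQ(5)])
    then show False using no by blast
  qed
qed

text \<open>Three such components would be the branches of a K_{2,3} minor with hubs
  \<open>s\<close> and \<open>t\<close>. This limits how many pieces can hang on the same pair of
  terminals.\<close>

lemma card_comps_touching:
  assumes no: "\<not> K23_minor E" and W: "finite W" "s \<notin> W" "t \<notin> W" "s \<noteq> t"
    and F: "F \<subseteq> comps E W" "\<And>C. C \<in> F \<Longrightarrow> touch E {s} C \<and> touch E {t} C"
  shows "card F \<le> 2"
proof (rule ccontr)
  assume "\<not> ?thesis"
  then have "3 \<le> card F" by simp
  then obtain G where "G \<subseteq> F" "card G = 3" by (metis obtain_subset_with_card_n)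
  then obtain X Y Z where XYZ: "X \<in> F" "Y \<in> F" "Z \<in> F" "X \<noteq> Y" "X \<noteq> Z" "Y \<noteq> Z"
    by (auto simp: card_3_iff)
  then have c: "X \<in> comps E W" "Y \<in> comps E W" "Z \<in> comps E W" using F(1) by blast+
  have t: "touch E {s} X" "touch E {s} Y" "touch E {s} Z" "touch E {t} X" "touch E {t} Y" "touch E {t} Z"
    using F(2) XYZ by blast+
  have sub: "X \<subseteq> W" "Y \<subseteq> W" "Z \<subseteq> W" using comps_subset c by blast+
  have d: "{s} \<inter> {t} = {}" "{s} \<inter> X = {}" "{s} \<inter> Y = {}" "{s} \<inter> Z = {}"
    "{t} \<inter> X = {}" "{t} \<inter> Y = {}" "{t} \<inter> Z = {}" using sub W by blast+
  have "K23_minor E"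
    by (rule K23_minorI[OF conn_singleton conn_singleton d(1)
      comps_conn[OF c(1)] d(2,5) t(1,4) comps_conn[OF c(2)] d(3,6) t(2,5) comps_conn[OF c(3)] d(4,7) t(3,6)
      comps_disjoint[OF c(1,2) XYZ(4)] comps_disjoint[OF c(1,3) XYZ(5)] comps_disjoint[OF c(2,3) XYZ(6)]])
  then show False using no by blast
qed

section \<open>Extending colorings\<close>

lemma circ_dist_commute: "circ_dist k a b = circ_dist k b a"
  by (simp add: circ_dist_def abs_minus_commute)

lemma nat_less_5: "(\<exists>c<5. P c) \<longleftrightarrow> P 0 \<or> P 1 \<or> P 2 \<or> P 3 \<or> P (4::nat)"
  by (auto simp: numeral_eq_Suc less_Suc_eq)

lemma less_5_cases: "(c::nat) < 5 \<longleftrightarrow> c = 0 \<or> c = 1 \<or> c = 2 \<or> c = 3 \<or> c = 4"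
  by auto

lemma color_at_distance_2:
  assumes "a < 5"
  shows "\<exists>c<5. circ_dist 5 a c = 2"
  using assms unfolding nat_less_5 unfolding less_5_cases by (elim disjE) (simp_all add: circ_dist_def)

text \<open>Two colors have distance 2 from \<open>a\<close>. If \<open>b\<close> has distance 1
  from \<open>a\<close>, the one farther from \<open>b\<close> is taken. If \<open>b\<close> has
  distance 2, then \<open>b\<close> is one of them and the other one is next to it.\<close>

lemma color_of_apex:
  assumes "a < 5" "b < 5" "a \<noteq> b"
  shows "\<exists>c<5. circ_dist 5 a c = 2 \<and> c \<noteq> b \<and> (circ_dist 5 b c = 1 \<longleftrightarrow> circ_dist 5 a b \<noteq> 1)"
  using assms unfolding nat_less_5 unfolding less_5_cases
  by (elim disjE) (simp_all add: circ_dist_def)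

definition bad_edge :: "'a set set \<Rightarrow> ('a \<Rightarrow> nat) \<Rightarrow> 'a \<Rightarrow> 'a \<Rightarrow> bool" where
  "bad_edge E f u v \<longleftrightarrow> {u, v} \<in> E \<and> circ_dist 5 (f u) (f v) = 1"

text \<open>The bad edges at a vertex of \<open>K\<close> are counted in the whole graph, including
  those that lead out of \<open>K\<close>.\<close>

definition good_coloring :: "'a set set \<Rightarrow> 'a set \<Rightarrow> ('a \<Rightarrow> nat) \<Rightarrow> bool" where
  "good_coloring E K f \<longleftrightarrow> (\<forall>u\<in>K. f u < 5 \<and> (\<forall>v. {u, v} \<in> E \<longrightarrow> f u \<noteq> f v) \<and> card {v. bad_edge E f u v} \<le> 4)"

text \<open>The function \<^term>\<open>m\<close> bounds how many bad edges a vertex outside \<^term>\<open>K\<close> receives from \<^term>\<open>K\<close>.\<close>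

definition extends :: "'a set set \<Rightarrow> ('a \<Rightarrow> nat) \<Rightarrow> 'a set \<Rightarrow> ('a \<Rightarrow> nat) \<Rightarrow> ('a \<Rightarrow> nat) \<Rightarrow> bool" where
  "extends E g K m f \<longleftrightarrow> (\<forall>v. v \<notin> K \<longrightarrow> f v = g v) \<and> good_coloring E K f \<and>
     (\<forall>t. t \<notin> K \<longrightarrow> card {u \<in> K. bad_edge E f t u} \<le> m t)"

text \<open>No edges run between different components, so their colorings can be chosen
  independently. Only a vertex outside \<open>W\<close> sees several components, and their
  contributions to it add up.\<close>

lemma glue:
  assumes "finite W" and "\<And>C. C \<in> comps E W \<Longrightarrow> \<exists>f. extends E g C (m C) f"
  shows "\<exists>f. extends E g W (\<lambda>t. \<Sum>C\<in>comps E W. m C t) f"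
proof -
  obtain F where F: "\<And>C. C \<in> comps E W \<Longrightarrow> extends E g C (m C) (F C)"
    using assms(2) by metis
  define f where "f v = (if v \<in> W then F (component E W v) v else g v)" for v
  have fF: "f v = F C v" if C: "C \<in> comps E W" and v: "v \<in> C \<or> v \<notin> W" for C v
  proof (cases "v \<in> W")
    case True
    then have "v \<in> C" using v by blast
    moreover have "component E W v \<in> comps E W" "v \<in> component E W v" using True by (rule component_in_comps component_self)+
    ultimately have "component E W v = C" using comps_disjoint[OF C] by blast
    then show ?thesis using True by (simp add: f_def)
  next
    case False
    then have "v \<notin> C" using comps_subset[OF C] by blast
    then show ?thesis using F[OF C] False by (simp add: f_def extends_def)
  qed
  have nb: "f v = F C v" if "C \<in> comps E W" "u \<in> C" "{u, v} \<in> E" for C u v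
    using fF[OF that(1), of v] comps_edge[OF that] by blast
  have bad: "bad_edge E f u v \<longleftrightarrow> bad_edge E (F C) u v" if "C \<in> comps E W" "u \<in> C" for C u v
    using nb[OF that] fF[OF that(1)] that(2) by (auto simp: bad_edge_def)
  have "good_coloring E W f"
    unfolding good_coloring_def
  proof
    fix u assume "u \<in> W"
    then obtain C where C: "C \<in> comps E W" "u \<in> C" using Union_comps[of E W] by blast
    have "good_coloring E C (F C)" using F[OF C(1)] by (simp add: extends_def)
    then have *: "F C u < 5" "\<forall>v. {u, v} \<in> E \<longrightarrow> F C u \<noteq> F C v" "card {v. bad_edge E (F C) u v} \<le> 4"
      using C(2) by (auto simp: good_coloring_def)
    moreover have "f u = F C u" using fF C by blast
    moreover have "{v. bad_edge E f u v} = {v. bad_edge E (F C) u v}" using bad[OF C] by simp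
    ultimately show "f u < 5 \<and> (\<forall>v. {u, v} \<in> E \<longrightarrow> f u \<noteq> f v) \<and> card {v. bad_edge E f u v} \<le> 4"
      using nb[OF C] by simp
  qed
  moreover have "card {u \<in> W. bad_edge E f t u} \<le> (\<Sum>C\<in>comps E W. m C t)" if t: "t \<notin> W" for t
  proof -
    have fin: "finite (comps E W)" using finite_comps assms(1) by blast
    have "{u \<in> W. bad_edge E f t u} \<subseteq> (\<Union>C\<in>comps E W. {u \<in> C. bad_edge E (F C) t u})"
    proof
      fix u assume u: "u \<in> {u \<in> W. bad_edge E f t u}"
      then obtain C where C: "C \<in> comps E W" "u \<in> C" using Union_comps[of E W] by blast
      have "bad_edge E (F C) t u" using u fF[OF C(1), of u] fF[OF C(1), of t] C(2) t by (simp add: bad_edge_def)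
      then show "u \<in> (\<Union>C\<in>comps E W. {u \<in> C. bad_edge E (F C) t u})" using C by blast
    qed
    moreover have "finite C" if "C \<in> comps E W" for C
      using comps_subset[OF that] assms(1) by (rule finite_subset)
    then have "finite (\<Union>C\<in>comps E W. {u \<in> C. bad_edge E (F C) t u})" using fin by simp
    ultimately have "card {u \<in> W. bad_edge E f t u} \<le> card (\<Union>C\<in>comps E W. {u \<in> C. bad_edge E (F C) t u})"
      by (meson card_mono)
    also have "\<dots> \<le> (\<Sum>C\<in>comps E W. card {u \<in> C. bad_edge E (F C) t u})"
      by (rule card_UN_le[OF fin])
    also have "\<dots> \<le> (\<Sum>C\<in>comps E W. m C t)"
    proof (rule sum_mono)
      fix C assume C: "C \<in> comps E W"
      then have "t \<notin> C" using comps_subset[OF C] t by blast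
      then show "card {u \<in> C. bad_edge E (F C) t u} \<le> m C t" using F[OF C] by (simp add: extends_def)
    qed
    finally show ?thesis .
  qed
  ultimately show ?thesis unfolding extends_def using f_def by (intro exI[of _ f]) simp
qed

text \<open>The vertex \<open>x\<close> was precolored as an outside vertex and now joins the piece.
  Its bad edges come from \<open>K - {x}\<close>, bounded by \<open>M x\<close>, and from outside
  vertices collected in \<open>T\<close>. A vertex outside \<open>K\<close> gains at most the edge
  to \<open>x\<close>.\<close>

lemma extends_insert:
  assumes f: "extends E (g(x := c)) (K - {x}) M f"
    and K: "finite K" "x \<in> K" "{x} \<notin> E" and c: "c < 5" "\<And>t. \<lbrakk>t \<notin> K; {x, t} \<in> E\<rbrakk> \<Longrightarrow> c \<noteq> g t"
    and out: "finite T" "\<And>t. \<lbrakk>t \<notin> K; {x, t} \<in> E; circ_dist 5 c (g t) = 1\<rbrakk> \<Longrightarrow> t \<in> T"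
    and x: "M x + card T \<le> 4"
    and m: "\<And>t. t \<notin> K \<Longrightarrow> M t + (if {x, t} \<in> E \<and> circ_dist 5 c (g t) = 1 then 1 else 0) \<le> m t"
  shows "extends E g K m f"
proof -
  have fx: "f x = c" and fo: "\<And>v. v \<notin> K \<Longrightarrow> f v = g v"
    using f K(2) by (auto simp: extends_def)
  have gd: "good_coloring E (K - {x}) f" and ld: "\<And>t. t \<notin> K - {x} \<Longrightarrow> card {u \<in> K - {x}. bad_edge E f t u} \<le> M t"
    using f by (auto simp: extends_def)
  have sym: "{u, v} \<in> E \<longleftrightarrow> {v, u} \<in> E" for u v by (simp add: insert_commute)
  have "good_coloring E K f"
    unfolding good_coloring_def
  proof
    fix u assume u: "u \<in> K"
    show "f u < 5 \<and> (\<forall>v. {u, v} \<in> E \<longrightarrow> f u \<noteq> f v) \<and> card {v. bad_edge E f u v} \<le> 4"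
    proof (cases "u = x")
      case False
      then show ?thesis using gd u by (simp add: good_coloring_def)
    next
      case True
      have "c \<noteq> f v" if v: "{x, v} \<in> E" for v
      proof (cases "v \<in> K")
        case True
        moreover have "v \<noteq> x" using v K(3) by auto
        ultimately have "f v \<noteq> f x" using gd v sym[of x v] by (simp add: good_coloring_def)
        then show ?thesis using fx by simp
      qed (use c(2) v fo in simp)
      moreover have "{v. bad_edge E f x v} \<subseteq> {v \<in> K - {x}. bad_edge E f x v} \<union> T"
      proof
        fix v assume v: "v \<in> {v. bad_edge E f x v}"
        then have "v \<noteq> x" using K(3) by (auto simp: bad_edge_def)
        then show "v \<in> {v \<in> K - {x}. bad_edge E f x v} \<union> T"
          using v out(2)[of v] fo[of v] fx by (cases "v \<in> K") (simp_all add: bad_edge_def)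
      qed
      then have "card {v. bad_edge E f x v} \<le> card ({v \<in> K - {x}. bad_edge E f x v} \<union> T)"
        using K(1) out(1) by (intro card_mono) simp_all
      then have "card {v. bad_edge E f x v} \<le> card {v \<in> K - {x}. bad_edge E f x v} + card T"
        using card_Un_le le_trans by blast
      then have "card {v. bad_edge E f x v} \<le> 4" using ld[of x] x by simp
      ultimately show ?thesis using True c(1) fx by simp
    qed
  qed
  moreover have "card {u \<in> K. bad_edge E f t u} \<le> m t" if t: "t \<notin> K" for t
  proof -
    have "{u \<in> K. bad_edge E f t u} \<subseteq> {u \<in> K - {x}. bad_edge E f t u} \<union>
        (if {x, t} \<in> E \<and> circ_dist 5 c (g t) = 1 then {x} else {})"
      using fo[OF t] fx by (auto simp: bad_edge_def insert_commute circ_dist_commute)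
    then have "card {u \<in> K. bad_edge E f t u} \<le> card ({u \<in> K - {x}. bad_edge E f t u} \<union>
        (if {x, t} \<in> E \<and> circ_dist 5 c (g t) = 1 then {x} else {}))"
      using K(1) by (intro card_mono) simp_all
    also have "\<dots> \<le> card {u \<in> K - {x}. bad_edge E f t u} +
        card (if {x, t} \<in> E \<and> circ_dist 5 c (g t) = 1 then {x} else {})"
      by (rule card_Un_le)
    also have "\<dots> \<le> M t + (if {x, t} \<in> E \<and> circ_dist 5 c (g t) = 1 then 1 else 0)"
      using ld[of t] t by simp
    also have "\<dots> \<le> m t" using m[OF t] .
    finally show ?thesis .
  qed
  ultimately show ?thesis unfolding extends_def using fo by blast
qed

section \<open>Pieces attached at one or two terminals\<close>

definition nbrs_in :: "'a set set \<Rightarrow> 'a set \<Rightarrow> 'a set \<Rightarrow> bool" where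
  "nbrs_in E K T \<longleftrightarrow> (\<forall>u\<in>K. \<forall>v. {u, v} \<in> E \<longrightarrow> v \<in> K \<union> T)"

lemma nbrs_in_comps:
  assumes "nbrs_in E K T" "C \<in> comps E (K - {x})"
  shows "nbrs_in E C (insert x {t \<in> T. touch E {t} C})"
  unfolding nbrs_in_def
proof (intro ballI allI impI)
  fix u v assume uv: "u \<in> C" "{u, v} \<in> E"
  have "u \<in> K" using uv comps_subset[OF assms(2)] by blast
  then have "v \<in> K \<union> T" using assms(1) uv(2) by (auto simp: nbrs_in_def)
  moreover have "v \<in> C" if "v \<in> K - {x}" using comps_edge[OF assms(2) uv that] .
  moreover have "touch E {v} C" using uv by (auto simp: touch_def insert_commute)
  ultimately show "v \<in> C \<union> insert x {t \<in> T. touch E {t} C}" by blast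
qed

text \<open>The bound is 0 because any number of such pieces may hang on the same vertex.\<close>

definition extendable1 :: "'a set set \<Rightarrow> 'a set \<Rightarrow> 'a \<Rightarrow> bool" where
  "extendable1 E K t \<longleftrightarrow> (\<forall>g. g t < 5 \<longrightarrow> (\<exists>f. extends E g K (\<lambda>_. 0) f))"

text \<open>The asymmetry lets the caller decide which terminal pays for a possible bad edge. In the
  induction the newly colored vertex is passed as \<open>q\<close>, so the old terminals pay
  nothing.\<close>

definition extendable2 :: "'a set set \<Rightarrow> 'a set \<Rightarrow> 'a \<Rightarrow> 'a \<Rightarrow> bool" where
  "extendable2 E K p q \<longleftrightarrow> (\<forall>g. g p < 5 \<and> g q < 5 \<and> g p \<noteq> g q \<longrightarrow>
     (\<exists>f. extends E g K (\<lambda>t. if t = q \<and> circ_dist 5 (g p) (g q) \<noteq> 1 then 1 else 0) f))"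

lemma extendable2D:
  assumes "extendable2 E K p q" "g p < 5" "g q < 5" "g p \<noteq> g q"
    "m = (\<lambda>t. if t = q \<and> circ_dist 5 (g p) (g q) \<noteq> 1 then 1 else 0)"
  shows "\<exists>f. extends E g K m f"
  using assms by (simp add: extendable2_def)

text \<open>
  The connection outside \<^term>\<open>K\<close> replaces the virtual edge between the terminals.
\<close>

definition linked :: "'a set set \<Rightarrow> 'a set \<Rightarrow> 'a \<Rightarrow> 'a \<Rightarrow> bool" where
  "linked E K p q \<longleftrightarrow> p \<noteq> q \<and> touch E {p} K \<and> touch E {q} K \<and>
     (\<exists>S. finite S \<and> conn E S \<and> p \<in> S \<and> q \<in> S \<and> S \<inter> K = {})"

lemma sum_indicator:
  assumes "finite A"
  shows "(\<Sum>C\<in>A. if R C then 1 else 0) = card {C \<in> A. R C}"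
  using assms by (simp add: sum.If_cases Int_def)

context
  fixes V :: "'a set" and E :: "'a set set"
  assumes simple: "simple_graph V E" and no23: "\<not> K23_minor E" and no4: "\<not> K4_subgraph E"
begin

lemma no_loop: "{x} \<notin> E"
  using simple by (auto simp: simple_graph_def)

text \<open>With \<open>x\<close> at distance 2 from \<open>t\<close>, their edge is not bad. A
  component of \<open>K - {x}\<close> touching \<open>t\<close> hangs on \<open>t\<close> and
  \<open>x\<close> and costs \<open>x\<close> at most one bad edge, and there are at most two of
  them. The others hang on \<open>x\<close> alone and cost nothing.\<close>

lemma extendable1_step:
  assumes K: "finite K" "conn E K" "t \<notin> K" "nbrs_in E K {t}"
    and IH1: "\<And>C s. \<lbrakk>C \<subset> K; conn E C; s \<notin> C; nbrs_in E C {s}\<rbrakk> \<Longrightarrow> extendable1 E C s"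
    and IH2: "\<And>C r s. \<lbrakk>C \<subset> K; conn E C; nbrs_in E C {r, s}; linked E C r s\<rbrakk> \<Longrightarrow> extendable2 E C r s"
  shows "extendable1 E K t"
  unfolding extendable1_def
proof (intro allI impI)
  fix g :: "'a \<Rightarrow> nat" assume gt: "g t < 5"
  \<comment> \<open>A neighbor of \<open>t\<close>, if it has one in \<open>K\<close>; otherwise any
    vertex of \<open>K\<close> will do.\<close>
  obtain x where x: "x \<in> K" "touch E {t} K \<Longrightarrow> {t, x} \<in> E"
    using conn_nonempty[OF K(2)] unfolding touch_def by blast
  have tx: "t \<noteq> x" using x(1) K(3) by blast
  obtain c where c: "c < 5" "circ_dist 5 (g t) c = 2" using color_at_distance_2[OF gt] by blast
  have ct: "c \<noteq> g t" using c(2) by (auto simp: circ_dist_def)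
  let ?W = "K - {x}" and ?g = "g(x := c)"
  define m where "m C s = (if s = x \<and> touch E {t} C then 1 else 0::nat)" for C s
  have "\<exists>f. extends E ?g C (m C) f" if C: "C \<in> comps E ?W" for C
  proof -
    have sub: "C \<subset> K" "x \<notin> C" "t \<notin> C" using comps_subset[OF C] x(1) K(3) by blast+
    have cC: "conn E C" using comps_conn[OF C] .
    have nb: "nbrs_in E C (insert x {s \<in> {t}. touch E {s} C})" using nbrs_in_comps[OF K(4) C] .
    have xC: "touch E {x} C" using conn_remove(2)[OF K(2) x(1) C] .
    show ?thesis
    proof (cases "touch E {t} C")
      case True
      then have "touch E {t} K" by (rule touch_mono) (use sub in auto)
      \<comment> \<open>The edge from \<open>t\<close> to \<open>x\<close> is itself the connection
        outside \<open>C\<close>.\<close>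
      then have "conn E ({t} \<union> {x})" using x(2) by (intro conn_Un) simp_all
      then have "linked E C t x"
        unfolding linked_def using tx True xC sub by (intro conjI exI[of _ "{t} \<union> {x}"]) auto
      moreover have "insert x {s \<in> {t}. touch E {s} C} = {t, x}" using True by auto
      ultimately have "extendable2 E C t x" using IH2[OF sub(1) cC] nb by simp
      moreover have "?g t < 5" "?g x < 5" "?g t \<noteq> ?g x" using gt c ct tx by simp_all
      moreover have "m C = (\<lambda>s. if s = x \<and> circ_dist 5 (?g t) (?g x) \<noteq> 1 then 1 else 0)"
        using True tx c(2) by (simp add: m_def fun_eq_iff)
      ultimately show ?thesis by (rule extendable2D)
    next
      case False
      then have "insert x {s \<in> {t}. touch E {s} C} = {x}" by auto
      with nb have "nbrs_in E C {x}" by (simp only:)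
      then have "extendable1 E C x" using IH1[OF sub(1) cC sub(2)] by blast
      then have "\<exists>f. extends E ?g C (\<lambda>_. 0) f" using c(1) unfolding extendable1_def by simp
      moreover have "m C = (\<lambda>_. 0)" using False by (simp add: m_def fun_eq_iff)
      ultimately show ?thesis by simp
    qed
  qed
  then obtain f where f: "extends E ?g ?W (\<lambda>s. \<Sum>C\<in>comps E ?W. m C s) f"
    using glue[of ?W E ?g m] K(1) by blast
  have fin: "finite (comps E ?W)" using K(1) finite_comps by blast
  have "(\<Sum>C\<in>comps E ?W. m C x) = card {C \<in> comps E ?W. touch E {t} C}"
    using sum_indicator[OF fin] by (simp add: m_def)
  also have "\<dots> \<le> 2"
    by (rule card_comps_touching[OF no23, of ?W t x]) (use K x tx conn_remove(2)[OF K(2) x(1)] in auto)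
  finally have Mx: "(\<Sum>C\<in>comps E ?W. m C x) \<le> 2" .
  have nbx: "s = t" if "s \<notin> K" "{x, s} \<in> E" for s
    using K(4) x(1) that unfolding nbrs_in_def by blast
  have "extends E g K (\<lambda>_. 0) f"
  proof (rule extends_insert[OF f K(1) x(1) no_loop c(1), of "{}"])
    fix s assume s: "s \<notin> K"
    then have "s \<noteq> x" using x(1) by blast
    then have "(\<Sum>C\<in>comps E ?W. m C s) = 0" by (simp add: m_def)
    then show "(\<Sum>C\<in>comps E ?W. m C s) + (if {x, s} \<in> E \<and> circ_dist 5 c (g s) = 1 then 1 else 0) \<le> 0"
      using nbx[OF s] c(2) by (auto simp: circ_dist_commute)
  next
    fix s assume s: "s \<notin> K" "{x, s} \<in> E"
    then show "c \<noteq> g s" using nbx[OF s] ct by simp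
    assume "circ_dist 5 c (g s) = 1"
    then show "s \<in> {}" using nbx[OF s] c(2) by (simp add: circ_dist_commute)
  qed (use Mx in simp_all)
  then show "\<exists>f. extends E g K (\<lambda>_. 0) f" by blast
qed

text \<open>As \<open>x\<close> separates the terminals, every component of \<open>K - {x}\<close>
  hangs on \<open>x\<close> and at most one of \<open>p\<close> and \<open>q\<close>, so the
  induction hypotheses cover all of them.\<close>

lemma extendable2_step:
  assumes K: "finite K" "conn E K" "nbrs_in E K {p, q}" "linked E K p q"
    and IH1: "\<And>C s. \<lbrakk>C \<subset> K; conn E C; s \<notin> C; nbrs_in E C {s}\<rbrakk> \<Longrightarrow> extendable1 E C s"
    and IH2: "\<And>C r s. \<lbrakk>C \<subset> K; conn E C; nbrs_in E C {r, s}; linked E C r s\<rbrakk> \<Longrightarrow> extendable2 E C r s"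
  shows "extendable2 E K p q"
  unfolding extendable2_def
proof (intro allI impI)
  fix g :: "'a \<Rightarrow> nat" assume g: "g p < 5 \<and> g q < 5 \<and> g p \<noteq> g q"
  obtain S where pq: "p \<noteq> q" "touch E {p} K" "touch E {q} K"
    and S: "finite S" "conn E S" "p \<in> S" "q \<in> S" "S \<inter> K = {}"
    using K(4) unfolding linked_def by blast
  obtain x where x: "x \<in> K" and sep: "\<And>C. C \<in> comps E (K - {x}) \<Longrightarrow> \<not> (touch E {p} C \<and> touch E {q} C)"
    using separating_vertex[OF no23 no4 K(1) S(1) K(2) S(2-5) pq] by blast
  have px: "p \<noteq> x" "q \<noteq> x" "p \<notin> K" "q \<notin> K" using x S by blast+
  obtain c where c: "c < 5" "circ_dist 5 (g p) c = 2" "c \<noteq> g q"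
    "circ_dist 5 (g q) c = 1 \<longleftrightarrow> circ_dist 5 (g p) (g q) \<noteq> 1"
    using color_of_apex g by blast
  have cp: "c \<noteq> g p" using c(2) by (auto simp: circ_dist_def)
  let ?W = "K - {x}" and ?g = "g(x := c)"
  \<comment> \<open>If \<open>d\<close> holds, the pieces on \<open>q\<close> and \<open>x\<close>
    may cost \<open>x\<close> one bad edge each, but an edge from \<open>x\<close> to
    \<open>q\<close> is not bad. Otherwise these pieces cost nothing and only that edge can be bad.
    With at most two pieces on \<open>p\<close> and \<open>x\<close>, the total at \<open>x\<close>
    is at most 2 + 2 or 2 + 1.\<close>
  define d where "d = (circ_dist 5 (g q) c \<noteq> 1)"
  define m where "m C s = (if s = x \<and> (touch E {p} C \<or> touch E {q} C \<and> d) then 1 else 0::nat)" for C s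
  have "\<exists>f. extends E ?g C (m C) f" if C: "C \<in> comps E ?W" for C
  proof -
    have sub: "C \<subset> K" "x \<notin> C" using comps_subset[OF C] x by blast+
    have cC: "conn E C" using comps_conn[OF C] .
    have nb: "nbrs_in E C (insert x {s \<in> {p, q}. touch E {s} C})" using nbrs_in_comps[OF K(3) C] .
    have xC: "touch E {x} C" using conn_remove(2)[OF K(2) x C] .
    \<comment> \<open>The detour from \<open>r\<close> to \<open>x\<close> outside \<open>C\<close>
      goes through \<open>S\<close> to the other terminal \<open>s\<close> and from there through
      \<open>K - C\<close>, which is connected and contains \<open>x\<close>.\<close>
    have link: "linked E C r x" if r: "r \<in> S" "touch E {r} C" and s: "s \<in> S" "touch E {s} K" "\<not> touch E {s} C" for r s
    proof -
      have "touch E {s} (K - C)" using s(2,3) unfolding touch_def by blast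
      then have "touch E S (K - C)" by (rule touch_mono) (use s in auto)
      then have "conn E (S \<union> (K - C))" using conn_Un[OF S(2) conn_remove(1)[OF K(2) x C]] by blast
      moreover have "r \<noteq> x" using r S x by blast
      ultimately show ?thesis
        unfolding linked_def using r xC S K(1) x sub
        by (intro conjI exI[of _ "S \<union> (K - C)"]) auto
    qed
    consider (p) "touch E {p} C" "\<not> touch E {q} C" | (q) "touch E {q} C" "\<not> touch E {p} C"
      | (none) "\<not> touch E {p} C" "\<not> touch E {q} C"
      using sep[OF C] by blast
    then show ?thesis
    proof cases
      case p
      have "linked E C p x" using link[OF S(3) p(1) S(4) pq(3) p(2)] .
      moreover have "insert x {s \<in> {p, q}. touch E {s} C} = {p, x}" using p by auto
      ultimately have "extendable2 E C p x" using IH2[OF sub(1) cC] nb by simp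
      moreover have "?g p < 5" "?g x < 5" "?g p \<noteq> ?g x" using g c cp px by simp_all
      moreover have "m C = (\<lambda>s. if s = x \<and> circ_dist 5 (?g p) (?g x) \<noteq> 1 then 1 else 0)"
        using p px c(2) by (simp add: m_def fun_eq_iff)
      ultimately show ?thesis by (rule extendable2D)
    next
      case q
      have "linked E C q x" using link[OF S(4) q(1) S(3) pq(2) q(2)] .
      moreover have "insert x {s \<in> {p, q}. touch E {s} C} = {q, x}" using q by auto
      ultimately have "extendable2 E C q x" using IH2[OF sub(1) cC] nb by simp
      moreover have "?g q < 5" "?g x < 5" "?g q \<noteq> ?g x" using g c px by simp_all
      moreover have "m C = (\<lambda>s. if s = x \<and> circ_dist 5 (?g q) (?g x) \<noteq> 1 then 1 else 0)"
        using q px by (simp add: m_def d_def fun_eq_iff)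
      ultimately show ?thesis by (rule extendable2D)
    next
      case none
      then have "insert x {s \<in> {p, q}. touch E {s} C} = {x}" by auto
      with nb have "nbrs_in E C {x}" by (simp only:)
      then have "extendable1 E C x" using IH1[OF sub(1) cC sub(2)] by blast
      then have "\<exists>f. extends E ?g C (\<lambda>_. 0) f" using c(1) unfolding extendable1_def by simp
      moreover have "m C = (\<lambda>_. 0)" using none by (simp add: m_def fun_eq_iff)
      ultimately show ?thesis by simp
    qed
  qed
  then obtain f where f: "extends E ?g ?W (\<lambda>s. \<Sum>C\<in>comps E ?W. m C s) f"
    using glue[of ?W E ?g m] K(1) by blast
  have fin: "finite (comps E ?W)" using K(1) finite_comps by blast
  have two: "card {C \<in> comps E ?W. touch E {r} C} \<le> 2" if "r \<notin> K" for r
    by (rule card_comps_touching[OF no23, of ?W r x]) (use K x that conn_remove(2)[OF K(2) x] in auto)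
  have "(\<Sum>C\<in>comps E ?W. m C x) = card {C \<in> comps E ?W. touch E {p} C \<or> touch E {q} C \<and> d}"
    using sum_indicator[OF fin] by (simp add: m_def)
  also have "\<dots> \<le> card ({C \<in> comps E ?W. touch E {p} C} \<union> (if d then {C \<in> comps E ?W. touch E {q} C} else {}))"
    by (intro card_mono) (use fin in auto)
  also have "\<dots> \<le> card {C \<in> comps E ?W. touch E {p} C} + card (if d then {C \<in> comps E ?W. touch E {q} C} else {})"
    by (rule card_Un_le)
  also have "\<dots> \<le> 2 + (if d then 2 else 0)"
    using two[OF px(3)] two[OF px(4)] by simp
  finally have Mx: "(\<Sum>C\<in>comps E ?W. m C x) \<le> 2 + (if d then 2 else 0)" .
  have nbx: "s = p \<or> s = q" if "s \<notin> K" "{x, s} \<in> E" for s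
    using K(3) x that unfolding nbrs_in_def by blast
  have "extends E g K (\<lambda>t. if t = q \<and> circ_dist 5 (g p) (g q) \<noteq> 1 then 1 else 0) f"
  proof (rule extends_insert[OF f K(1) x no_loop c(1), of "if d then {} else {q}"])
    fix s assume s: "s \<notin> K"
    then have "s \<noteq> x" using x by blast
    then have "(\<Sum>C\<in>comps E ?W. m C s) = 0" by (simp add: m_def)
    then show "(\<Sum>C\<in>comps E ?W. m C s) + (if {x, s} \<in> E \<and> circ_dist 5 c (g s) = 1 then 1 else 0)
        \<le> (if s = q \<and> circ_dist 5 (g p) (g q) \<noteq> 1 then 1 else 0)"
      using nbx[OF s] c(2,4) by (auto simp: circ_dist_commute)
  next
    fix s assume s: "s \<notin> K" "{x, s} \<in> E"
    then show "c \<noteq> g s" using nbx[OF s] cp c(3) by auto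
    assume "circ_dist 5 c (g s) = 1"
    then show "s \<in> (if d then {} else {q})" using nbx[OF s] c(2) by (auto simp: circ_dist_commute d_def)
  qed (use Mx in \<open>auto split: if_splits\<close>)
  then show "\<exists>f. extends E g K (\<lambda>t. if t = q \<and> circ_dist 5 (g p) (g q) \<noteq> 1 then 1 else 0) f" by blast
qed

text \<open>Both statements are proved in one induction on \<open>K\<close>, since deleting a vertex
  leaves pieces of both kinds.\<close>

lemma extendable:
  assumes "finite K" "conn E K"
  shows "\<lbrakk>t \<notin> K; nbrs_in E K {t}\<rbrakk> \<Longrightarrow> extendable1 E K t"
    and "\<lbrakk>nbrs_in E K {p, q}; linked E K p q\<rbrakk> \<Longrightarrow> extendable2 E K p q"
proof -
  have "(\<forall>t. t \<notin> K \<and> nbrs_in E K {t} \<longrightarrow> extendable1 E K t) \<and>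
    (\<forall>p q. nbrs_in E K {p, q} \<and> linked E K p q \<longrightarrow> extendable2 E K p q)"
    using assms
  proof (induction K rule: finite_psubset_induct)
    case (psubset K)
    have IH1: "extendable1 E C s" if "C \<subset> K" "conn E C" "s \<notin> C" "nbrs_in E C {s}" for C s
      using psubset.IH[OF that(1,2)] that(3,4) by blast
    have IH2: "extendable2 E C r s" if "C \<subset> K" "conn E C" "nbrs_in E C {r, s}" "linked E C r s" for C r s
      using psubset.IH[OF that(1,2)] that(3,4) by blast
    show ?case
    proof (intro conjI allI impI)
      fix t assume "t \<notin> K \<and> nbrs_in E K {t}"
      then show "extendable1 E K t"
        by (intro extendable1_step[OF psubset.hyps psubset.prems _ _ IH1 IH2]) simp_all
    next
      fix p q assume "nbrs_in E K {p, q} \<and> linked E K p q"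
      then show "extendable2 E K p q"
        by (intro extendable2_step[OF psubset.hyps psubset.prems _ _ IH1 IH2]) simp_all
    qed
  qed
  then show "\<lbrakk>t \<notin> K; nbrs_in E K {t}\<rbrakk> \<Longrightarrow> extendable1 E K t"
    and "\<lbrakk>nbrs_in E K {p, q}; linked E K p q\<rbrakk> \<Longrightarrow> extendable2 E K p q" by simp_all
qed

lemma half_star_colorable_5_4: "half_star_colorable 5 4 V E"
proof (cases "V = {}")
  case True
  then show ?thesis by (auto simp: half_star_colorable_def half_star_coloring_def)
next
  case False
  then obtain r where r: "r \<in> V" by blast
  have finV: "finite V" and EV: "\<And>e. e \<in> E \<Longrightarrow> e \<subseteq> V" using simple by (auto simp: simple_graph_def)
  \<comment> \<open>An arbitrary root \<open>r\<close> gets color 0, and every component of the rest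
    hangs on \<open>r\<close> alone, also when the graph is disconnected. The update at
    \<open>r\<close> is spelled out to fit \<open>extends_insert\<close>.\<close>
  let ?W = "V - {r}" and ?g = "(\<lambda>_. 0::nat)(r := 0)"
  have "\<exists>f. extends E ?g C (\<lambda>_. 0) f" if C: "C \<in> comps E ?W" for C
  proof -
    have "C \<subseteq> ?W" using comps_subset[OF C] .
    moreover have "nbrs_in E V {}" using EV by (auto simp: nbrs_in_def)
    then have "nbrs_in E C {r}" using nbrs_in_comps[of E V "{}" C r] C by simp
    ultimately have "extendable1 E C r"
      using extendable(1)[of C r] comps_conn[OF C] finV finite_subset by blast
    then show ?thesis unfolding extendable1_def by simp
  qed
  then obtain f where f: "extends E ?g ?W (\<lambda>t. \<Sum>C\<in>comps E ?W. 0) f"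
    using glue[of ?W E ?g "\<lambda>_ _. 0"] finV by blast
  have "extends E (\<lambda>_. 0) V (\<lambda>_. 0) f"
    by (rule extends_insert[OF f finV r no_loop, of "{}"]) (use EV in auto)
  then have good: "good_coloring E V f" by (simp add: extends_def)
  have "half_star_coloring 5 4 V E f"
    unfolding half_star_coloring_def
  proof (intro conjI ballI impI)
    show "f \<in> V \<rightarrow> {0..<5}" using good by (auto simp: good_coloring_def)
    show "f u \<noteq> f v" if "u \<in> V" "{u, v} \<in> E" for u v using good that by (simp add: good_coloring_def)
    fix u assume u: "u \<in> V"
    have "{v \<in> V. {u, v} \<in> E \<and> circ_dist 5 (f u) (f v) = 1} = {v. bad_edge E f u v}"
      using EV by (auto simp: bad_edge_def)
    then show "card {v \<in> V. {u, v} \<in> E \<and> circ_dist 5 (f u) (f v) = 1} \<le> 4"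
      using good u by (simp add: good_coloring_def)
  qed
  then show ?thesis unfolding half_star_colorable_def by blast
qed

end

section \<open>Excluded minors of outerplanar drawings\<close>

context outerplanar_drawing begin

lemma no_K4_subgraph: "\<not> K4_subgraph E"
  using no_K4 unfolding K4_subgraph_def by blast

text \<open>Every vertex of such a set has an incident edge. This places branch sets in
  \<open>V\<close>, which the definition of a minor does not state.\<close>

lemma conn_touch_subset:
  assumes "conn E S" "touch E S T"
  shows "S \<subseteq> V"
proof
  fix v assume v: "v \<in> S"
  have "touch E {v} T \<or> touch E {v} (S - {v})"
    using conn_touch[OF assms(1), of "{v}"] v assms(2) by (cases "S = {v}") auto
  then obtain w where "{v, w} \<in> E" by (auto simp: touch_def)
  then show "v \<in> V" using simple by (auto simp: simple_graph_def)
qed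

text \<open>Applying \<open>singleton_hub\<close> to each hub turns the minor into three disjoint
  connected branches between two vertices, the situation of \<open>no_theta\<close>.\<close>

lemma no_K23_minor: "\<not> K23_minor E"
proof
  assume "K23_minor E"
  then obtain A A' B where A: "conn E A" "conn E A'" "A \<inter> A' = {}"
    and B: "\<forall>i<3::nat. conn E (B i) \<and> A \<inter> B i = {} \<and> A' \<inter> B i = {} \<and> touch E A (B i) \<and> touch E A' (B i)"
    and disj: "\<forall>i<3. \<forall>j<3. i \<noteq> j \<longrightarrow> B i \<inter> B j = {}"
    unfolding K23_minor_def by blast
  have t: "touch E A (B 0)" "touch E A' (B 0)" using B[rule_format, of 0] by simp_all
  have AV: "A \<subseteq> V" "A' \<subseteq> V" using conn_touch_subset A(1,2) t by blast+
  have fin: "finite A" "finite A'" using AV simple finite_subset unfolding simple_graph_def by blast+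
  have B1: "\<forall>i<3. conn E (B i) \<and> A \<inter> B i = {} \<and> touch E A (B i)" using B by blast
  obtain a C where a: "a \<in> A"
    and C: "\<forall>i<3. conn E (C i) \<and> touch E {a} (C i) \<and> B i \<subseteq> C i \<and> C i \<subseteq> B i \<union> (A - {a})"
    and Cd: "\<forall>i<3. \<forall>j<3. i \<noteq> j \<longrightarrow> C i \<inter> C j = {}"
    using singleton_hub[OF fin(1) A(1) B1 disj] by blast
  have "conn E (C i) \<and> A' \<inter> C i = {} \<and> touch E A' (C i)" if "i < 3" for i
  proof -
    have *: "B i \<subseteq> C i" "C i \<subseteq> B i \<union> (A - {a})" "touch E A' (B i)" "A' \<inter> B i = {}" "conn E (C i)"
      using B C that by simp_all
    have "touch E A' (C i)" by (rule touch_mono[OF *(3)]) (use * in auto)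
    moreover have "A' \<inter> C i = {}" using *(2,4) A(3) by blast
    ultimately show ?thesis using *(5) by blast
  qed
  then have C1: "\<forall>i<3. conn E (C i) \<and> A' \<inter> C i = {} \<and> touch E A' (C i)" by blast
  obtain b D where b: "b \<in> A'"
    and D: "\<forall>i<3. conn E (D i) \<and> touch E {b} (D i) \<and> C i \<subseteq> D i \<and> D i \<subseteq> C i \<union> (A' - {b})"
    and Dd: "\<forall>i<3. \<forall>j<3. i \<noteq> j \<longrightarrow> D i \<inter> D j = {}"
    using singleton_hub[OF fin(2) A(2) C1 Cd] by blast
  have D1: "conn E (D i)" "touch E {b} (D i)" "touch E {a} (D i)" "D i \<subseteq> V" "a \<notin> D i" "b \<notin> D i"
    if "i < 3" for i
  proof -
    have *: "C i \<subseteq> D i" "D i \<subseteq> C i \<union> (A' - {b})" "touch E {a} (C i)" "C i \<subseteq> B i \<union> (A - {a})"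
      "A' \<inter> C i = {}" "A \<inter> B i = {}"
      using B C C1 D that by simp_all
    show cb: "conn E (D i)" "touch E {b} (D i)" using D that by simp_all
    show "touch E {a} (D i)" by (rule touch_mono[OF *(3)]) (use * in auto)
    show "D i \<subseteq> V" using conn_touch_subset[OF cb(1)] cb(2) touch_sym[of E "{b}"] by blast
    show "a \<notin> D i" using *(2,4,6) a A(3) by blast
    \<comment> \<open>Branches may absorb parts of both hubs, but the second application leaves out
      \<open>b\<close> itself, and \<open>C i\<close> is disjoint from \<open>A'\<close>.\<close>
    show "b \<notin> D i" using *(2,5) b by blast
  qed
  have d: "D 0 \<inter> D 1 = {}" "D 0 \<inter> D 2 = {}" "D 1 \<inter> D 2 = {}"
    using Dd by simp_all
  have l: "0 < (3::nat)" "1 < (3::nat)" "2 < (3::nat)" by simp_all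
  show False
  proof (rule no_theta[of a "D 0" "D 1" "D 2" b])
    show "a \<in> V" "b \<in> V" "a \<noteq> b" using a b AV A(3) by blast+
    show "a \<notin> D 0 \<union> D 1 \<union> D 2" "b \<notin> D 0 \<union> D 1 \<union> D 2"
      using D1(5,6)[OF l(1)] D1(5,6)[OF l(2)] D1(5,6)[OF l(3)] by blast+
  qed (use d D1[OF l(1)] D1[OF l(2)] D1[OF l(3)] in blast)+
qed

end

theorem theorem5p6:
  fixes V :: "'a set" and E :: "'a set set"
  assumes "simple_graph V E" and "outerplanar V E"
  shows "half_star_colorable 5 4 V E"
proof -
  obtain p c where pc: "planar_drawing V E p c" "p ` V \<subseteq> frontier (outside (drawing_points V E p c))"
    using assms(2) unfolding outerplanar_def by blast
  then interpret outerplanar_drawing V E p c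
    using assms(1) pc by unfold_locales
  show ?thesis
    by (rule half_star_colorable_5_4[OF assms(1) no_K23_minor no_K4_subgraph])
qed

end
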